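(* Let $X$ be a real Banach space with continuous dual $X^*$, and let $A\colon X\rightrightarrows X^*$ be a maximally monotone operator. Then the following are equivalent: (i) $A$ is of type (D) (dense type); (ii) $A$ is of type (NI) (negative infimum); (iii) $A$ is of type (FP) (Fitzpatrick-Phelps).
   Context: $X$ is a real Banach space, $X^*$ its continuous dual, $X^{**}$ its bidual; $\langle\cdot,\cdot\rangle$ denotes the duality pairings (between $X$ and $X^*$, and between $X^*$ and $X^{**}$, written in either order), and $X$ is identified with its canonical image in $X^{**}$. A set-valued operator $A\colon X\rightrightarrows X^*$ assigns to each $x\in X$ a (possibly empty) subset $Ax\subseteq X^*$. Its graph is $\operatorname{gra}A=\{(x,x^* )\in X\times X^* \mid x^*\in Ax\}$ and its range is $\operatorname{ran}A=\bigcup_{x\in X}Ax$. $A$ is monotone if $\langle x-y,x^*-y^*\rangle\ge 0$ for all $(x,x^* ),(y,y^* )\in\operatorname{gra}A$; a subset of $X\times X^*$ is called monotone if it is the graph of a monotone operator. $A$ is maximally monotone if it is monotone and admits no proper monotone extension (i.e. no monotone subset of $X\times X^*$ properly contains $\operatorname{gra}A$). A point $(x,x^* )\in X\times X^*$ is monotonically related to a monotone set $G\subseteq X\times X^*$ if $\{(x,x^* )\}\cup G$ is monotone. Let $A$ be maximally monotone. Type (D): $A$ is of type (D) if for every $(x^{**},x^* )\in X^{**}\times X^*$ with $$\inf_{(a,a^* )\in\operatorname{gra}A}\langle a-x^{**},a^*-x^*\rangle\ge 0,$$ there exists a bounded net $(a_\alpha,a^*_\alpha)_{\alpha\in\Gamma}$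 in $\operatorname{gra}A$ that converges to $(x^{**},x^* )$ in the weak*$\times$strong topology, i.e. $a_\alpha\to x^{**}$ in the weak* topology of $X^{**}$ (the topology $\sigma(X^{**},X^* )$) and $a^*_\alpha\to x^*$ in the norm of $X^*$. Type (NI): $A$ is of type (NI) if $$\sup_{(a,a^* )\in\operatorname{gra}A}\big(\langle a,x^*\rangle+\langle a^*,x^{**}\rangle-\langle a,a^*\rangle\big)\ge\langle x^{**},x^*\rangle\quad\text{for all }(x^{**},x^* )\in X^{**}\times X^*,$$ where the supremum is taken in the extended reals. Type (FP): $A$ is of type (FP) if whenever $U$ is an open (in norm) convex subset of $X^*$ with $U\cap\operatorname{ran}A\neq\varnothing$, $x^*\in U$, and $(x,x^* )\in X\times X^*$ is monotonically related to $\operatorname{gra}A\cap(X\times U)$, it follows that $(x,x^* )\in\operatorname{gra}A$. *)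

theory Defs
  imports "HOL-Analysis.Analysis"
begin

type_synonym 'a dual = "'a \<Rightarrow>\<^sub>L real"
type_synonym 'a bidual = "('a \<Rightarrow>\<^sub>L real) \<Rightarrow>\<^sub>L real"

lift_definition canonical_embedding :: "'a::real_normed_vector \<Rightarrow> 'a bidual"
  is "\<lambda>x f. blinfun_apply f x"
  by (rule blinfun.bounded_linear_left)


section \<open>Monotone operators\<close>

definition gra :: "('a \<Rightarrow> 'b set) \<Rightarrow> ('a \<times> 'b) set" where
  "gra A = {(x, x'). x' \<in> A x}"

definition ran_op :: "('a \<Rightarrow> 'b set) \<Rightarrow> 'b set" where
  "ran_op A = (\<Union>x. A x)"

definition monotone_set :: "('a::real_normed_vector \<times> 'a dual) set \<Rightarrow> bool" where
  "monotone_set G \<longleftrightarrow> (\<forall>(x, x') \<in> G. \<forall>(y, y') \<in> G. blinfun_apply (x' - y') (x - y) \<ge> 0)"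

definition maximally_monotone :: "('a::real_normed_vector \<Rightarrow> 'a dual set) \<Rightarrow> bool" where
  "maximally_monotone A \<longleftrightarrow>
     monotone_set (gra A) \<and> \<not> (\<exists>G. monotone_set G \<and> gra A \<subset> G)"

definition monotonically_related ::
    "'a::real_normed_vector \<times> 'a dual \<Rightarrow> ('a \<times> 'a dual) set \<Rightarrow> bool" where
  "monotonically_related p G \<longleftrightarrow> monotone_set ({p} \<union> G)"


section \<open>Nets\<close>

definition directed_set :: "'i set \<Rightarrow> ('i \<Rightarrow> 'i \<Rightarrow> bool) \<Rightarrow> bool" where
  "directed_set \<Gamma> le \<longleftrightarrow>
     \<Gamma> \<noteq> {} \<and>
     (\<forall>i\<in>\<Gamma>. le i i) \<and>
     (\<forall>i\<in>\<Gamma>. \<forall>j\<in>\<Gamma>. \<forall>k\<in>\<Gamma>. le i j \<longrightarrow> le j k \<longrightarrow> le i k) \<and>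
     (\<forall>i\<in>\<Gamma>. \<forall>j\<in>\<Gamma>. \<exists>k\<in>\<Gamma>. le i k \<and> le j k)"

definition net_filter :: "'i set \<Rightarrow> ('i \<Rightarrow> 'i \<Rightarrow> bool) \<Rightarrow> 'i filter" where
  "net_filter \<Gamma> le = (INF i\<in>\<Gamma>. principal {j\<in>\<Gamma>. le i j})"

lemma eventually_net_filter:
  assumes "directed_set \<Gamma> le"
  shows "eventually P (net_filter \<Gamma> le) \<longleftrightarrow> (\<exists>i\<in>\<Gamma>. \<forall>j\<in>\<Gamma>. le i j \<longrightarrow> P j)"
proof -
  have ne: "\<Gamma> \<noteq> {}"
    using assms by (simp add: directed_set_def)
  have base: "\<exists>k\<in>\<Gamma>. principal {l\<in>\<Gamma>. le k l} \<le>
      inf (principal {l\<in>\<Gamma>. le i l}) (principal {l\<in>\<Gamma>. le j l})"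
    if ij: "i \<in> \<Gamma>" "j \<in> \<Gamma>" for i j
  proof -
    obtain k where k: "k \<in> \<Gamma>" "le i k" "le j k"
      using assms ij unfolding directed_set_def by meson
    have "le i l \<and> le j l" if "l \<in> \<Gamma>" "le k l" for l
      using assms ij k that unfolding directed_set_def by meson
    with k(1) show ?thesis
      by (intro bexI[of _ k]) auto
  qed
  show ?thesis
    unfolding net_filter_def
    by (subst eventually_INF_base[OF ne base]) (auto simp: eventually_principal)
qed

text \<open>
  For a second argument of type \<^typ>\<open>real\<close>, \<^const>\<open>strong_operator_topology\<close> is the topology of
  pointwise convergence on a dual space; on \<open>'a bidual\<close>, the dual of \<open>'a dual\<close>, it is thus the
  weak* topology \<open>\<sigma>(X**, X*)\<close>.
\<close>

definition bounded_net_limit ::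
    "('a::real_normed_vector \<times> 'a dual) set \<Rightarrow> 'i set \<Rightarrow> ('i \<Rightarrow> 'i \<Rightarrow> bool) \<Rightarrow>
     ('i \<Rightarrow> 'a \<times> 'a dual) \<Rightarrow> 'a bidual \<times> 'a dual \<Rightarrow> bool" where
  "bounded_net_limit G \<Gamma> le z p \<longleftrightarrow>
     directed_set \<Gamma> le \<and> z ` \<Gamma> \<subseteq> G \<and> bounded (z ` \<Gamma>) \<and>
     limitin (prod_topology strong_operator_topology euclidean)
       (\<lambda>i. (canonical_embedding (fst (z i)), snd (z i))) p (net_filter \<Gamma> le)"


section \<open>Types (D), (NI) and (FP)\<close>

text \<open>
  HOL cannot quantify existentially over the type of the indices of a net, so that type is fixed
  in the next definition: an index set is a set of subsets of \<open>X** \<times> X*\<close>. This is no restriction,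
  since neighbourhoods of the limit can always serve as indices, as the lemma following the
  definition shows.
\<close>

definition type_D :: "('a::real_normed_vector \<Rightarrow> 'a dual set) \<Rightarrow> bool" where
  "type_D A \<longleftrightarrow>
     (\<forall>x'' x'.
        (INF (a, a') \<in> gra A.
           ereal (blinfun_apply (canonical_embedding a - x'') (a' - x'))) \<ge> 0 \<longrightarrow>
        (\<exists>(\<Gamma> :: ('a bidual \<times> 'a dual) set set) le z.
           bounded_net_limit (gra A) \<Gamma> le z (x'', x')))"

lemma bounded_net_limit_reindex:
  fixes \<Gamma> :: "'i set" and z :: "'i \<Rightarrow> 'a::real_normed_vector \<times> 'a dual"
  assumes "bounded_net_limit G \<Gamma> le z p"
  shows "\<exists>(\<Gamma>' :: ('a bidual \<times> 'a dual) set set) le' z'. bounded_net_limit G \<Gamma>' le' z' p"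
proof -
  define T :: "('a bidual \<times> 'a dual) topology"
    where "T = prod_topology strong_operator_topology euclidean"
  define h :: "'a \<times> 'a dual \<Rightarrow> 'a bidual \<times> 'a dual"
    where "h = (\<lambda>q. (canonical_embedding (fst q), snd q))"
  have dir: "directed_set \<Gamma> le" and sub: "z ` \<Gamma> \<subseteq> G" and bdd: "bounded (z ` \<Gamma>)"
    and lim: "limitin T (\<lambda>i. h (z i)) p (net_filter \<Gamma> le)"
    using assms unfolding bounded_net_limit_def T_def h_def by auto
  have p: "p \<in> topspace T"
    using lim by (simp add: limitin_def)
  define \<Gamma>' where "\<Gamma>' = {U. openin T U \<and> p \<in> U}"
  define le' :: "('a bidual \<times> 'a dual) set \<Rightarrow> _" where "le' = (\<lambda>U V. V \<subseteq> U)"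
  have "\<exists>q. q \<in> z ` \<Gamma> \<and> h q \<in> U" if "U \<in> \<Gamma>'" for U
  proof -
    have "eventually (\<lambda>i. h (z i) \<in> U) (net_filter \<Gamma> le)"
      using lim that by (simp add: limitin_def \<Gamma>'_def)
    then obtain i where i: "i \<in> \<Gamma>" "\<And>j. j \<in> \<Gamma> \<Longrightarrow> le i j \<Longrightarrow> h (z j) \<in> U"
      unfolding eventually_net_filter[OF dir] by blast
    have "le i i"
      using dir i(1) by (simp add: directed_set_def)
    with i show ?thesis by blast
  qed
  then obtain z' where z': "\<And>U. U \<in> \<Gamma>' \<Longrightarrow> z' U \<in> z ` \<Gamma> \<and> h (z' U) \<in> U"
    by metis
  have dir': "directed_set \<Gamma>' le'"
    unfolding directed_set_def
  proof (intro conjI ballI impI)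
    show "\<Gamma>' \<noteq> {}"
      using p unfolding \<Gamma>'_def by blast
  next
    fix U V assume "U \<in> \<Gamma>'" "V \<in> \<Gamma>'"
    then show "\<exists>W\<in>\<Gamma>'. le' U W \<and> le' V W"
      by (intro bexI[of _ "U \<inter> V"]) (auto simp: \<Gamma>'_def le'_def)
  qed (auto simp: le'_def)
  have "limitin T (\<lambda>U. h (z' U)) p (net_filter \<Gamma>' le')"
    unfolding limitin_def
  proof (intro conjI p allI impI)
    fix U assume "openin T U \<and> p \<in> U"
    then have "U \<in> \<Gamma>'" by (simp add: \<Gamma>'_def)
    then show "eventually (\<lambda>V. h (z' V) \<in> U) (net_filter \<Gamma>' le')"
      unfolding eventually_net_filter[OF dir'] using z' by (auto simp: le'_def)
  qed
  moreover have sub': "z' ` \<Gamma>' \<subseteq> z ` \<Gamma>"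
    using z' by blast
  ultimately have "bounded_net_limit G \<Gamma>' le' z' p"
    using dir' sub bounded_subset[OF bdd sub']
    unfolding bounded_net_limit_def T_def h_def by auto
  then show ?thesis by blast
qed

definition type_NI :: "('a::real_normed_vector \<Rightarrow> 'a dual set) \<Rightarrow> bool" where
  "type_NI A \<longleftrightarrow>
     (\<forall>(x'' :: 'a bidual) (x' :: 'a dual).
        (SUP (a, a') \<in> gra A.
           ereal (blinfun_apply x' a + blinfun_apply x'' a' - blinfun_apply a' a))
        \<ge> ereal (blinfun_apply x'' x'))"

definition type_FP :: "('a::real_normed_vector \<Rightarrow> 'a dual set) \<Rightarrow> bool" where
  "type_FP A \<longleftrightarrow>
     (\<forall>U. open U \<and> convex U \<and> U \<inter> ran_op A \<noteq> {} \<longrightarrow>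
        (\<forall>x x'. x' \<in> U \<and> monotonically_related (x, x') (gra A \<inter> (UNIV \<times> U)) \<longrightarrow>
           (x, x') \<in> gra A))"

end

theory Submission
  imports Defs
begin

text \<open>
  Let \<open>C\<close> be the convex hull of the points \<open>(a, a', a' a)\<close> with \<open>(a, a')\<close> in the graph. A functional
  separating \<open>C\<close> from an open convex subset of \<open>X \<times> X* \<times> \<real>\<close> is a triple \<open>(z', z'', t)\<close>, and (NI)
  bounds \<open>z'' z'\<close> by the supremum of that functional (with \<open>t = -1\<close>) over the graph. Hence (NI) forces
  \<open>C\<close> to meet suitable open convex sets: sublevel sets of a quadratic, which gives approximate
  solutions of a regularised problem around any \<open>(x, x')\<close>, and small neighbourhoods of a point
  \<open>(x'', x')\<close> related to the graph. Iterating the former gives a Brondsted-Rockafellar property, which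
  turns points \<open>(x, x', r)\<close> of \<open>C\<close> with a small gap \<open>r - x' x\<close> into nearby points of the graph.
  Together these yield (D). For (FP) the quadratic is replaced by a steep penalty around the segment
  joining \<open>x'\<close> to a point of the range in \<open>U\<close>.

  Conversely, (D) gives (NI) directly. If (FP) holds and \<open>(x'', x')\<close> violates (NI), choose \<open>a'\<close> in the range
  and \<open>x\<close> in \<open>X\<close>, norm-bounded and close to \<open>x''\<close> on the single functional \<open>a' - x'\<close>. Then \<open>(x, x')\<close> is
  strictly related to the graph over a thin neighbourhood of the segment from \<open>x'\<close> to \<open>a'\<close>, so it is not
  in the graph, contradicting (FP).
\<close>

section \<open>Hahn-Banach separation\<close>

definition sublinear :: "('v::real_vector \<Rightarrow> real) \<Rightarrow> bool" where
  "sublinear p \<longleftrightarrow> (\<forall>x y. p (x + y) \<le> p x + p y) \<and> (\<forall>c\<ge>0. \<forall>x. p (c *\<^sub>R x) = c * p x)"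

lemma sublinearI:
  assumes add: "\<And>x y. p (x + y) \<le> p x + p y"
    and scale: "\<And>c x. c > 0 \<Longrightarrow> p (c *\<^sub>R x) \<le> c * p x"
    and zero: "p 0 = 0"
  shows "sublinear p"
proof -
  have "p (c *\<^sub>R x) = c * p x" if "c \<ge> 0" for c x
  proof (cases "c = 0")
    case False
    with that have c: "c > 0" by simp
    have "p x \<le> inverse c * p (c *\<^sub>R x)"
      using scale[of "inverse c" "c *\<^sub>R x"] c by simp
    then have "c * p x \<le> p (c *\<^sub>R x)"
      using c by (simp add: field_simps)
    with scale[OF c, of x] show ?thesis by linarith
  qed (simp add: zero)
  with add show ?thesis by (simp add: sublinear_def)
qed

lemma sublinear_add: "sublinear p \<Longrightarrow> p (x + y) \<le> p x + p y"
  and sublinear_scale: "sublinear p \<Longrightarrow> c \<ge> 0 \<Longrightarrow> p (c *\<^sub>R x) = c * p x"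
  by (auto simp: sublinear_def)

lemma sublinear_zero: "sublinear p \<Longrightarrow> p 0 = 0"
  using sublinear_scale[of p 0 0] by simp

lemma sublinear_minus: "sublinear p \<Longrightarrow> - p (- x) \<le> p x"
  using sublinear_add[of p x "- x"] sublinear_zero[of p] by simp

text \<open>Lowering \<open>q\<close> along the cone \<open>K\<close> keeps it sublinear because
  \<open>g\<close> is superadditive there, and keeps it finite because \<open>g\<close> is dominated
  by \<open>q\<close>. With \<open>g = q\<close> on a ray this prescribes a value; with
  \<open>g = 0\<close> and \<open>q = norm\<close> it gives the distance to
  \<open>- K\<close>.\<close>

lemma sublinear_INF_cone:
  fixes q g :: "'v::real_vector \<Rightarrow> real"
  assumes q: "sublinear q"
    and K0: "0 \<in> K" and Kadd: "\<And>c d. c \<in> K \<Longrightarrow> d \<in> K \<Longrightarrow> c + d \<in> K"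
    and Kscale: "\<And>t c. t > 0 \<Longrightarrow> c \<in> K \<Longrightarrow> t *\<^sub>R c \<in> K"
    and gadd: "\<And>c d. c \<in> K \<Longrightarrow> d \<in> K \<Longrightarrow> g c + g d \<le> g (c + d)"
    and gscale: "\<And>t c. t > 0 \<Longrightarrow> c \<in> K \<Longrightarrow> g (t *\<^sub>R c) = t * g c"
    and g0: "g 0 = 0" and gq: "\<And>c. c \<in> K \<Longrightarrow> g c \<le> q c"
  defines "P \<equiv> \<lambda>x. INF c\<in>K. q (x + c) - g c"
  shows "sublinear P" "P x \<le> q x" "c \<in> K \<Longrightarrow> P (- c) \<le> - g c"
proof -
  have lower: "- q (- x) \<le> q (x + c) - g c" if "c \<in> K" for x c
    using sublinear_add[OF q, of "x + c" "- x"] gq[OF that] by simp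
  then have bdd: "bdd_below ((\<lambda>c. q (x + c) - g c) ` K)" for x
    by (auto intro!: bdd_belowI2)
  have le: "P x \<le> q (x + c) - g c" if "c \<in> K" for x c
    unfolding P_def by (intro cINF_lower bdd that)
  have ge: "m \<le> P x" if "\<And>c. c \<in> K \<Longrightarrow> m \<le> q (x + c) - g c" for m x
    unfolding P_def using K0 that by (intro cINF_greatest) auto
  show "P x \<le> q x" for x
    using le[OF K0, of x] g0 by simp
  show "P (- c) \<le> - g c" if "c \<in> K" for c
    using le[OF that, of "- c"] sublinear_zero[OF q] by simp
  show "sublinear P"
  proof (rule sublinearI)
    fix x y
    \<comment> \<open>The two infima are taken in turn: over \<open>d\<close> with \<open>c\<close>
      fixed, then over \<open>c\<close>.\<close>
    have "P (x + y) - (q (x + c) - g c) \<le> P y" if c: "c \<in> K" for c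
    proof (rule ge)
      fix d assume d: "d \<in> K"
      have "P (x + y) \<le> q (x + y + (c + d)) - g (c + d)"
        by (intro le Kadd c d)
      also have "\<dots> \<le> q (x + c) + q (y + d) - (g c + g d)"
        using sublinear_add[OF q, of "x + c" "y + d"] gadd[OF c d] by (simp add: algebra_simps)
      finally show "P (x + y) - (q (x + c) - g c) \<le> q (y + d) - g d" by simp
    qed
    then have "P (x + y) - P y \<le> q (x + c) - g c" if "c \<in> K" for c
      using that by fastforce
    from ge[OF this] show "P (x + y) \<le> P x + P y" by simp
  next
    fix t :: real and x assume t: "t > 0"
    have "P (t *\<^sub>R x) / t \<le> q (x + c) - g c" if c: "c \<in> K" for c
    proof -
      have "P (t *\<^sub>R x) \<le> q (t *\<^sub>R x + t *\<^sub>R c) - g (t *\<^sub>R c)"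
        by (intro le Kscale c t)
      also have "\<dots> = t * (q (x + c) - g c)"
        using t c gscale sublinear_scale[OF q, of t "x + c"] by (simp add: algebra_simps)
      finally show ?thesis using t by (simp add: field_simps)
    qed
    from ge[OF this] show "P (t *\<^sub>R x) \<le> t * P x" using t by (simp add: field_simps)
  next
    have "P 0 \<le> 0" using le[OF K0, of 0] g0 sublinear_zero[OF q] by simp
    moreover have "0 \<le> P 0"
      using lower[of _ 0] sublinear_zero[OF q] by (intro ge) simp
    ultimately show "P 0 = 0" by simp
  qed
qed

text \<open>On the ray through \<open>y\<close> the functional \<open>q\<close> is additive, so
  \<open>g = q\<close> is admissible in \<open>sublinear_INF_cone\<close>. This serves both to
  preserve the value at a given point and to show that minimal sublinear functionals are
  odd.\<close>

lemma sublinear_INF_ray: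
  fixes q :: "'v::real_vector \<Rightarrow> real"
  assumes q: "sublinear q"
  obtains P where "sublinear P" "\<And>x. P x \<le> q x" "P (- y) \<le> - q y"
proof -
  let ?K = "{t *\<^sub>R y | t. t \<ge> 0}"
  have *: "0 \<in> ?K" "\<And>c d. c \<in> ?K \<Longrightarrow> d \<in> ?K \<Longrightarrow> c + d \<in> ?K"
    "\<And>t c. t > 0 \<Longrightarrow> c \<in> ?K \<Longrightarrow> t *\<^sub>R c \<in> ?K"
    "\<And>t c. t > 0 \<Longrightarrow> c \<in> ?K \<Longrightarrow> q (t *\<^sub>R c) = t * q c" "q 0 = 0" "\<And>c. c \<in> ?K \<Longrightarrow> q c \<le> q c"
    using sublinear_scale[OF q] sublinear_zero[OF q]
    by (auto intro: exI[of _ 0] exI[of _ 1] simp flip: scaleR_left_distrib)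
  have add: "q c + q d \<le> q (c + d)" if "c \<in> ?K" "d \<in> ?K" for c d
    using that sublinear_scale[OF q] by (auto simp flip: scaleR_left_distrib simp: distrib_right)
  have "y \<in> ?K" by (auto intro: exI[of _ 1])
  with sublinear_INF_cone[of q ?K q, OF q *(1-3) add *(4-6)] that show ?thesis
    by blast
qed

text \<open>Zorn's lemma for the reversed pointwise order. The infimum of a chain is finite because
  every sublinear \<open>q\<close> below \<open>p\<close> satisfies
  \<open>- p (- x) \<le> q x\<close>.\<close>

lemma minimal_sublinear:
  fixes p :: "'v::real_vector \<Rightarrow> real"
  assumes p: "sublinear p"
  obtains f where "sublinear f" "\<And>x. f x \<le> p x"
    "\<And>q. sublinear q \<Longrightarrow> (\<And>x. q x \<le> f x) \<Longrightarrow> q = f"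
proof -
  let ?S = "{q. sublinear q \<and> q \<le> p}"
  let ?R = "\<lambda>q r :: 'v \<Rightarrow> real. r \<le> q"
  have "\<exists>m\<in>?S. \<forall>a\<in>?S. a \<le> m \<longrightarrow> a = m"
  proof (rule predicate_Zorn[of ?S ?R])
    show "partial_order_on ?S (relation_of ?R ?S)"
      by (rule partial_order_on_relation_ofI) auto
  next
    fix C assume C: "C \<in> Chains (relation_of ?R ?S)"
    then have CS: "C \<subseteq> ?S" and chain: "\<And>a b. a \<in> C \<Longrightarrow> b \<in> C \<Longrightarrow> a \<le> b \<or> b \<le> a"
      by (auto simp: Chains_def relation_of_def)
    show "\<exists>u\<in>?S. \<forall>a\<in>C. u \<le> a"
    proof (cases "C = {}")
      case True
      then show ?thesis using p by blast
    next
      case False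
      define u where "u x = (INF q\<in>C. q x)" for x
      have sub: "sublinear q" "q x \<le> p x" if "q \<in> C" for q x
        using CS that by (auto simp: le_fun_def)
      have "- p (- x) \<le> q x" if "q \<in> C" for q x
        using sublinear_minus[OF sub(1)[OF that], of x] sub(2)[OF that, of "- x"] by simp
      then have bdd: "bdd_below ((\<lambda>q. q x) ` C)" for x
        by (auto intro!: bdd_belowI2)
      have le: "u x \<le> q x" if "q \<in> C" for q x
        unfolding u_def by (intro cINF_lower bdd that)
      have ge: "m \<le> u x" if "\<And>q. q \<in> C \<Longrightarrow> m \<le> q x" for m x
        unfolding u_def using False that by (intro cINF_greatest) auto
      have "sublinear u"
      proof (rule sublinearI)
        fix x y
        have *: "u (x + y) \<le> q x + r y" if qr: "q \<in> C" "r \<in> C" for q r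
        proof -
          \<comment> \<open>The smaller of \<open>q\<close> and \<open>r\<close> works at both
            points; this is where the chain property gives subadditivity.\<close>
          obtain s where s: "s \<in> C" "s x \<le> q x" "s y \<le> r y"
            using chain[OF qr] qr by (auto simp: le_fun_def)
          show ?thesis
            using le[OF s(1), of "x + y"] sublinear_add[OF sub(1)[OF s(1)], of x y] s by linarith
        qed
        have "u (x + y) - q x \<le> u y" if "q \<in> C" for q
          using *[OF that] by (intro ge) (simp add: algebra_simps)
        then have "u (x + y) - u y \<le> u x"
          by (intro ge) (simp add: algebra_simps)
        then show "u (x + y) \<le> u x + u y" by simp
      next
        fix t :: real and x assume t: "t > 0"
        have "u (t *\<^sub>R x) / t \<le> u x"
        proof (rule ge)
          fix q assume "q \<in> C"
          then show "u (t *\<^sub>R x) / t \<le> q x"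
            using le[of q "t *\<^sub>R x"] sublinear_scale[OF sub(1), of q t x] t
            by (simp add: field_simps)
        qed
        then show "u (t *\<^sub>R x) \<le> t * u x" using t by (simp add: field_simps)
      next
        have "(\<lambda>q. q 0) ` C = {0}"
          using False sublinear_zero[OF sub(1)] by force
        then show "u 0 = 0" by (simp add: u_def)
      qed
      moreover have "u \<le> p"
      proof (intro le_funI)
        fix x
        obtain q where "q \<in> C" using False by blast
        then show "u x \<le> p x" using le[of q x] sub(2)[of q x] by linarith
      qed
      ultimately show ?thesis using le by (auto simp: le_fun_def)
    qed
  qed
  then obtain f where f: "sublinear f" "f \<le> p" "\<And>a. a \<in> ?S \<Longrightarrow> a \<le> f \<Longrightarrow> a = f" by blast
  show ?thesis
  proof (rule that)
    fix q assume "sublinear q" "\<And>x. q x \<le> f x"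
    then show "q = f" using f order_trans[of q f p] by (auto simp: le_fun_def)
  qed (use f in \<open>auto simp: le_fun_def\<close>)
qed

text \<open>A minimal sublinear functional is linear: \<open>sublinear_INF_ray\<close> would lower
  it further unless it is odd, and an odd sublinear functional is additive. Minimising below
  \<open>p'\<close> instead of \<open>p\<close> forces equality at \<open>y\<close>.\<close>

lemma hahn_banach_sublinear:
  fixes p :: "'v::real_vector \<Rightarrow> real"
  assumes "sublinear p"
  obtains f where "linear f" "\<And>x. f x \<le> p x" "f y = p y"
proof -
  obtain p' where p': "sublinear p'" "\<And>x. p' x \<le> p x" "p' (- y) \<le> - p y"
    using sublinear_INF_ray[OF assms] by blast
  obtain f where f: "sublinear f" "\<And>x. f x \<le> p' x"
    and minimal: "\<And>q. sublinear q \<Longrightarrow> (\<And>x. q x \<le> f x) \<Longrightarrow> q = f"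
    using minimal_sublinear[OF p'(1)] by blast
  have neg: "f (- x) = - f x" for x
  proof -
    obtain q where q: "sublinear q" "\<And>x. q x \<le> f x" "q (- x) \<le> - f x"
      using sublinear_INF_ray[OF f(1)] by blast
    with minimal[OF q(1,2)] sublinear_minus[OF f(1), of x] show ?thesis by simp
  qed
  have add: "f (x + z) = f x + f z" for x z
    using sublinear_add[OF f(1), of x z] sublinear_add[OF f(1), of "x + z" "- z"] neg[of z] by simp
  have "f (c *\<^sub>R x) = c *\<^sub>R f x" for c x
  proof (cases "c \<ge> 0")
    case False
    then show ?thesis
      using sublinear_scale[OF f(1), of "- c" x] neg[of "c *\<^sub>R x"] by simp
  qed (simp add: sublinear_scale[OF f(1)])
  with add have lin: "linear f" by (intro linearI) auto
  show ?thesis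
  proof (rule that[OF lin])
    show "f x \<le> p x" for x using f(2)[of x] p'(2)[of x] by linarith
    then show "f y = p y"
      using f(2)[of "- y"] p'(3) neg[of y] by (intro antisym) auto
  qed
qed

text \<open>Let \<open>p\<close> be the distance to \<open>- K\<close>, where \<open>K\<close> is
  the cone generated by \<open>E\<close>. A linear functional below \<open>p\<close> is bounded by
  the norm and nonnegative on \<open>E\<close>; choosing it to agree with \<open>p\<close> at an
  interior point \<open>e\<close>, where \<open>p e > 0\<close>, makes it nonzero, and openness of
  \<open>E\<close> makes it strictly positive.\<close>

lemma separating_functional_open_zero:
  fixes E :: "'v::real_normed_vector set"
  assumes E: "open E" "convex E" "0 \<notin> E"
  obtains f :: "'v \<Rightarrow>\<^sub>L real" where "\<And>x. x \<in> E \<Longrightarrow> 0 < blinfun_apply f x"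
proof (cases "E = {}")
  case True
  then show ?thesis using that by blast
next
  case False
  then obtain e where e: "e \<in> E" by blast
  then obtain r where r: "r > 0" "ball e r \<subseteq> E"
    using E(1) openE by blast
  let ?K = "insert 0 {t *\<^sub>R x | t x. t > 0 \<and> x \<in> E}"
  have K_add: "c + d \<in> ?K" if cd: "c \<in> ?K" "d \<in> ?K" for c d
  proof (cases "c = 0 \<or> d = 0")
    case False
    then obtain t x s y where *: "c = t *\<^sub>R x" "d = s *\<^sub>R y" "t > 0" "s > 0" "x \<in> E" "y \<in> E"
      using cd by blast
    then have "(t / (t + s)) *\<^sub>R x + (s / (t + s)) *\<^sub>R y \<in> E"
      by (intro convexD[OF E(2)]) (auto simp flip: add_divide_distrib)
    moreover have "c + d = (t + s) *\<^sub>R ((t / (t + s)) *\<^sub>R x + (s / (t + s)) *\<^sub>R y)"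
      using * by (simp add: scaleR_add_right)
    moreover have "t + s > 0" using * by simp
    ultimately show ?thesis by blast
  qed (use cd in auto)
  have K_scale: "t *\<^sub>R c \<in> ?K" if tc: "t > 0" "c \<in> ?K" for t c
    using tc by (auto, metis mult_pos_pos)
  have norm_sub: "sublinear (norm :: 'v \<Rightarrow> real)"
    by (intro sublinearI) (auto simp: norm_triangle_ineq)
  define p where "p = (\<lambda>x. INF c\<in>?K. norm (x + c) - (\<lambda>_. 0) c)"
  have p: "sublinear p" "\<And>x. p x \<le> norm x" "\<And>c. c \<in> ?K \<Longrightarrow> p (- c) \<le> 0"
    using sublinear_INF_cone[of norm ?K "\<lambda>_. 0", OF norm_sub _ K_add K_scale]
    unfolding p_def by auto
  have "r \<le> norm (e + c)" if c: "c \<in> ?K" for c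
  proof (rule ccontr)
    assume "\<not> r \<le> norm (e + c)"
    then have "- c \<in> ball e r" by (simp add: dist_norm)
    then have m: "- c \<in> E" using r by blast
    with E(3) have "c \<noteq> 0" by auto
    with c obtain t x where tx: "c = t *\<^sub>R x" "t > 0" "x \<in> E" by blast
    \<comment> \<open>Since \<open>c\<close> is \<open>t\<close> times \<open>x\<close>, this convex
      combination is 0.\<close>
    have "(1 / (1 + t)) *\<^sub>R (- c) + (t / (1 + t)) *\<^sub>R x \<in> E"
      using tx m by (intro convexD[OF E(2)]) (auto simp: field_simps)
    with tx E(3) show False by simp
  qed
  then have "r \<le> p e"
    unfolding p_def by (intro cINF_greatest) auto
  obtain f where f: "linear f" "\<And>x. f x \<le> p x" "f e = p e"
    using hahn_banach_sublinear[OF p(1)] by blast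
  have "\<bar>f x\<bar> \<le> norm x" for x
    using f(2)[of x] f(2)[of "- x"] p(2)[of x] p(2)[of "- x"] linear_neg[OF f(1), of x] by simp
  then have bl: "bounded_linear f"
    using f(1) by (intro bounded_linear_intro[where K = 1]) (auto simp: linear_iff)
  show ?thesis
  proof (rule that)
    fix x assume x: "x \<in> E"
    then obtain d where d: "d > 0" "ball x d \<subseteq> E"
      using E(1) openE by blast
    \<comment> \<open>Shifting \<open>x\<close> by at most \<open>d / 2\<close> against
      \<open>e\<close> stays in \<open>E\<close>, which yields the strict bound
      \<open>f x \<ge> s * f e > 0\<close>.\<close>
    define s where "s = d / (2 * (norm e + 1))"
    have ge: "norm e + 1 > 0" by (simp add: add_nonneg_pos)
    have s: "s > 0" using d(1) ge unfolding s_def by simp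
    have "s * norm e \<le> d / 2"
      using d(1) ge unfolding s_def by (simp add: field_simps)
    then have "s * norm e < d" using d(1) by linarith
    then have "x - s *\<^sub>R e \<in> ball x d"
      using s by (simp add: dist_norm)
    then have "x - s *\<^sub>R e \<in> E" using d by blast
    then have "x - s *\<^sub>R e \<in> ?K" by (auto intro: exI[of _ 1])
    then have "f (- (x - s *\<^sub>R e)) \<le> 0"
      using p(3) f(2) order_trans by blast
    then have "s * f e \<le> f x"
      using linear_neg[OF f(1)] linear_diff[OF f(1)] linear_cmul[OF f(1)] by simp
    moreover have "s * f e > 0" using s f(3) \<open>r \<le> p e\<close> r by simp
    ultimately show "0 < blinfun_apply (Blinfun f) x"
      by (simp add: bounded_linear_Blinfun_apply[OF bl])
  qed
qed

text \<open>The difference set \<open>D - C\<close> is open, convex and avoids 0. The level is the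
  supremum over \<open>C\<close>; moving a point of the open set \<open>D\<close> slightly towards
  \<open>C\<close> shows that it is not attained on \<open>D\<close>.\<close>

lemma separating_functional_open:
  fixes C D :: "'v::real_normed_vector set"
  assumes C: "convex C" "C \<noteq> {}" and D: "open D" "convex D" "D \<noteq> {}" and disj: "C \<inter> D = {}"
  obtains f :: "'v \<Rightarrow>\<^sub>L real" and b where "\<And>x. x \<in> C \<Longrightarrow> blinfun_apply f x \<le> b"
    "\<And>x. x \<in> D \<Longrightarrow> b < blinfun_apply f x"
proof -
  let ?E = "\<Union>x\<in>D. \<Union>y\<in>C. {x - y}"
  have "?E = {x + y | x y. x \<in> D \<and> y \<in> uminus ` C}" by force
  then have "open ?E" using open_sums[of D "uminus ` C"] D(1) by simp
  moreover have "convex ?E" by (rule convex_differences[OF D(2) C(1)])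
  moreover have "0 \<notin> ?E" using disj by auto
  ultimately obtain f :: "'v \<Rightarrow>\<^sub>L real" where f: "\<And>x. x \<in> ?E \<Longrightarrow> 0 < blinfun_apply f x"
    using separating_functional_open_zero by blast
  have less: "blinfun_apply f y < blinfun_apply f x" if "x \<in> D" "y \<in> C" for x y
    using f[of "x - y"] that by (auto simp: blinfun.diff_right)
  obtain d where d: "d \<in> D" using D(3) by blast
  define b where "b = (SUP y\<in>C. blinfun_apply f y)"
  have bdd: "bdd_above (blinfun_apply f ` C)"
    using less[OF d] by (auto intro!: bdd_aboveI2 less_imp_le)
  have le: "blinfun_apply f y \<le> b" if "y \<in> C" for y
    unfolding b_def by (intro cSUP_upper bdd that)
  have ge: "b \<le> blinfun_apply f x" if "x \<in> D" for x
    unfolding b_def using C(2) less[OF that] by (intro cSUP_least) (auto intro: less_imp_le)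
  obtain c where c: "c \<in> C" using C(2) by blast
  have "b < blinfun_apply f x" if x: "x \<in> D" for x
  proof -
    obtain r where r: "r > 0" "ball x r \<subseteq> D" using D(1) x openE by blast
    define s where "s = r / (2 * (norm (x - c) + 1))"
    have pos: "norm (x - c) + 1 > 0" by (simp add: add_nonneg_pos)
    have s: "s > 0" using r(1) pos unfolding s_def by simp
    have "s * norm (x - c) \<le> r / 2"
      using r(1) pos unfolding s_def by (simp add: field_simps)
    then have "s * norm (x - c) < r" using r(1) by linarith
    then have "x - s *\<^sub>R (x - c) \<in> ball x r"
      using s by (simp add: dist_norm)
    then have "b \<le> blinfun_apply f (x - s *\<^sub>R (x - c))" using r ge by blast
    also have "\<dots> = blinfun_apply f x - s * (blinfun_apply f x - blinfun_apply f c)"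
      by (simp add: blinfun.bilinear_simps)
    also have "\<dots> < blinfun_apply f x" using s less[OF x c] by simp
    finally show ?thesis .
  qed
  with le show ?thesis using that by blast
qed

section \<open>Goldstine approximation\<close>

lemma canonical_embedding_apply [simp]: "blinfun_apply (canonical_embedding x) f = blinfun_apply f x"
  by (simp add: canonical_embedding.rep_eq)

lemma linear_canonical_embedding: "linear canonical_embedding"
  by (intro linearI blinfun_eqI) (auto simp: blinfun.bilinear_simps)

lemma canonical_embedding_zero [simp]: "canonical_embedding 0 = 0"
  using linear_0[OF linear_canonical_embedding] .

text \<open>Induction on \<open>F\<close>. If \<open>\<phi>\<close> does not already vanish on the
  common kernel of \<open>F\<close>, some \<open>e\<close> in that kernel has value 1 at
  \<open>\<phi>\<close>, and subtracting \<open>f e\<close> times evaluation at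
  \<open>\<phi>\<close> leaves a functional covered by the induction hypothesis.\<close>

lemma evaluation_functional_of_finite_kernel:
  fixes f :: "'v::real_normed_vector bidual \<Rightarrow> real"
  assumes "finite F" "linear f"
    and "\<forall>y. (\<forall>\<phi>\<in>F. blinfun_apply y \<phi> = 0) \<longrightarrow> f y = 0"
  shows "\<exists>g. \<forall>y. f y = blinfun_apply y g"
  using assms
proof (induction F arbitrary: f rule: finite_induct)
  case empty
  then show ?case by (intro exI[of _ 0]) simp
next
  case (insert \<phi> F)
  show ?case
  proof (cases "\<forall>e :: 'v bidual. (\<forall>\<psi>\<in>F. blinfun_apply e \<psi> = 0) \<longrightarrow> blinfun_apply e \<phi> = 0")
    case True
    then have "\<forall>y. (\<forall>\<psi>\<in>F. blinfun_apply y \<psi> = 0) \<longrightarrow> f y = 0"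
      using insert.prems(2) by simp
    with insert.prems(1) show ?thesis by (rule insert.IH)
  next
    case False
    then obtain e0 :: "'v bidual" where e0: "\<forall>\<psi>\<in>F. blinfun_apply e0 \<psi> = 0" "blinfun_apply e0 \<phi> \<noteq> 0"
      by blast
    define e where "e = (1 / blinfun_apply e0 \<phi>) *\<^sub>R e0"
    have e: "\<forall>\<psi>\<in>F. blinfun_apply e \<psi> = 0" "blinfun_apply e \<phi> = 1"
      using e0 by (auto simp: e_def blinfun.scaleR_left)
    define h where "h = (\<lambda>y. f y - f e * blinfun_apply y \<phi>)"
    have lin: "linear h"
      using insert.prems(1) unfolding h_def
      by (intro linearI) (auto simp: linear_add linear_cmul blinfun.bilinear_simps algebra_simps)
    have "\<forall>y. (\<forall>\<psi>\<in>F. blinfun_apply y \<psi> = 0) \<longrightarrow> h y = 0"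
    proof (intro allI impI)
      fix y :: "'v bidual" assume y: "\<forall>\<psi>\<in>F. blinfun_apply y \<psi> = 0"
      have "f (y - blinfun_apply y \<phi> *\<^sub>R e) = 0"
        by (rule insert.prems(2)[rule_format]) (use e y in \<open>auto simp: blinfun.bilinear_simps\<close>)
      then show "h y = 0"
        using insert.prems(1) by (simp add: h_def linear_diff linear_cmul)
    qed
    from insert.IH[OF lin this] obtain g where g: "\<forall>y. h y = blinfun_apply y g" ..
    have "f y = blinfun_apply y (g + f e *\<^sub>R \<phi>)" for y
      using g[rule_format, of y]
      unfolding h_def blinfun.add_right blinfun.scaleR_right real_scaleR_def by linarith
    then have "\<forall>y. f y = blinfun_apply y (g + f e *\<^sub>R \<phi>)" ..
    then show ?thesis ..
  qed
qed

text \<open>Otherwise \<open>y\<close> is separated from \<open>D\<close>, the embedded ball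
  thickened by a weak* neighbourhood of 0. That neighbourhood contains the common kernel of
  \<open>F\<close>, so the separating functional is evaluation at some \<open>g\<close>; the
  estimate \<open>M * norm g \<le> norm y * norm g\<close> then forces \<open>g = 0\<close>.\<close>

lemma goldstine:
  fixes y :: "'v::real_normed_vector bidual"
  assumes F: "finite F" and M: "norm y < M" and e: "e > 0"
  obtains x where "norm x < M" "\<forall>\<phi>\<in>F. \<bar>blinfun_apply \<phi> x - blinfun_apply y \<phi>\<bar> < e"
proof -
  define N where "N = {z :: 'v bidual. \<forall>\<phi>\<in>F. \<bar>blinfun_apply z \<phi>\<bar> < e}"
  define D where "D = (\<Union>x\<in>ball 0 M. (+) (canonical_embedding x) ` N)"
  have Mpos: "M > 0" using M norm_ge_zero[of y] by linarith
  have N_open: "open N"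
  proof -
    have "N = (\<Inter>\<phi>\<in>F. {z. \<bar>blinfun_apply z \<phi>\<bar> < e})" by (auto simp: N_def)
    moreover have "open {z :: 'v bidual. \<bar>blinfun_apply z \<phi>\<bar> < e}" for \<phi>
      by (intro open_Collect_less continuous_intros)
    ultimately show ?thesis using F by auto
  qed
  have N_convex: "convex N"
  proof (rule convexI)
    fix a b u v
    assume ab: "a \<in> N" "b \<in> N" and uv: "0 \<le> u" "0 \<le> v" "u + v = (1::real)"
    have "\<bar>u * blinfun_apply a \<phi> + v * blinfun_apply b \<phi>\<bar> < e" if "\<phi> \<in> F" for \<phi>
    proof -
      have "convex {-e<..<e}" by simp
      moreover have "blinfun_apply a \<phi> \<in> {-e<..<e}" "blinfun_apply b \<phi> \<in> {-e<..<e}"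
        using ab that by (auto simp: N_def abs_less_iff)
      ultimately have "u *\<^sub>R blinfun_apply a \<phi> + v *\<^sub>R blinfun_apply b \<phi> \<in> {-e<..<e}"
        using uv by (intro convexD)
      then show ?thesis by auto
    qed
    then show "u *\<^sub>R a + v *\<^sub>R b \<in> N"
      by (simp add: N_def blinfun.bilinear_simps)
  qed
  have D: "open D" "convex D"
  proof -
    show "open D" unfolding D_def using N_open by (auto intro!: open_translation)
    have "D = (\<Union>x\<in>canonical_embedding ` ball 0 M. \<Union>z\<in>N. {x + z})" by (auto simp: D_def)
    then show "convex D"
      using convex_sums[OF convex_linear_image[OF linear_canonical_embedding convex_ball[of 0 M]] N_convex] by simp
  qed
  have "0 \<in> N" using e by (simp add: N_def)
  show ?thesis
  proof (cases "y \<in> D")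
    case True
    then obtain x z where x: "norm x < M" and z: "z \<in> N" and y: "y = canonical_embedding x + z"
      by (auto simp: D_def)
    from z have "\<bar>blinfun_apply \<phi> x - blinfun_apply y \<phi>\<bar> < e" if "\<phi> \<in> F" for \<phi>
      using that by (simp add: N_def y blinfun.bilinear_simps)
    with that x show ?thesis by blast
  next
    case False
    have mem: "canonical_embedding x + z \<in> D" if "norm x < M" "z \<in> N" for x z
      using that by (auto simp: D_def)
    have "D \<noteq> {}" using mem[of 0 0] Mpos \<open>0 \<in> N\<close> by auto
    then obtain f :: "'v bidual \<Rightarrow>\<^sub>L real" and b where "blinfun_apply f y \<le> b"
      and "\<And>x. x \<in> D \<Longrightarrow> b < blinfun_apply f x"
      using separating_functional_open[of "{y}" D] D False by auto
    then have f: "blinfun_apply f y < blinfun_apply f x" if "x \<in> D" for x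
      using that by fastforce
    have ker: "\<forall>z. (\<forall>\<phi>\<in>F. blinfun_apply z \<phi> = 0) \<longrightarrow> blinfun_apply f z = 0"
    proof (intro allI impI, rule ccontr)
      fix z assume z: "\<forall>\<phi>\<in>F. blinfun_apply z \<phi> = 0" and nz: "blinfun_apply f z \<noteq> 0"
      \<comment> \<open>At this multiple of \<open>z\<close>, a point of \<open>D\<close>, the
        functional takes exactly the value \<open>f y\<close>, against strict separation.\<close>
      have "(blinfun_apply f y / blinfun_apply f z) *\<^sub>R z \<in> N"
        using z e by (simp add: N_def blinfun.bilinear_simps)
      from f[OF mem[OF _ this, of 0]] nz Mpos show False
        by (simp add: blinfun.bilinear_simps)
    qed
    then obtain g where g: "\<And>z. blinfun_apply f z = blinfun_apply z g"
      using evaluation_functional_of_finite_kernel[OF F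
          bounded_linear.linear[OF blinfun.bounded_linear_right[of f]] ker] by blast
    have lt: "blinfun_apply y g < blinfun_apply g x" if "norm x < M" for x
      using f[OF mem[OF that \<open>0 \<in> N\<close>]] by (simp add: g blinfun.bilinear_simps)
    have "M * norm g \<le> - blinfun_apply y g"
    proof -
      have neg: "blinfun_apply y g < 0" using lt[of 0] Mpos by simp
      have "norm g \<le> - blinfun_apply y g / M"
      proof (rule norm_blinfun_bound)
        show "0 \<le> - blinfun_apply y g / M" using neg Mpos by (simp add: divide_nonpos_pos)
        fix x :: 'v
        have *: "blinfun_apply g x \<le> - blinfun_apply y g / M * norm x" for x
        proof (cases "x = 0")
          case False
          show ?thesis
          proof (rule field_le_mult_one_interval)
            fix t :: real assume t: "0 < t" "t < 1"
            \<comment> \<open>The argument has norm \<open>t * M < M\<close>; the bound follows as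
              \<open>t\<close> tends to 1.\<close>
            have "blinfun_apply y g < blinfun_apply g ((- t * M / norm x) *\<^sub>R x)"
              using t Mpos False by (intro lt) auto
            then have "t * M / norm x * blinfun_apply g x < - blinfun_apply y g"
              by (simp add: blinfun.bilinear_simps)
            then show "t * blinfun_apply g x \<le> - blinfun_apply y g / M * norm x"
              using Mpos False by (simp add: field_simps)
          qed
        qed simp
        show "norm (blinfun_apply g x) \<le> - blinfun_apply y g / M * norm x"
          using *[of x] *[of "- x"] by (simp add: abs_le_iff blinfun.minus_right)
      qed
      then show ?thesis using Mpos by (simp add: field_simps)
    qed
    also have "\<dots> \<le> norm y * norm g"
      using norm_blinfun[of y g] by simp
    finally have "norm g * (M - norm y) \<le> 0" by (simp add: algebra_simps)
    then have "g = 0" using M by (simp add: mult_le_0_iff)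
    with lt[of 0] Mpos show ?thesis by (simp add: blinfun.bilinear_simps)
  qed
qed

section \<open>Quadratic estimates and functionals on product spaces\<close>

text \<open>The bound is minus the Fenchel conjugate of the quadratic. It is obtained by testing
  only vectors of norm \<open>l * norm z\<close>, the radius at which the infimum is
  approached.\<close>

lemma inf_linear_plus_square:
  fixes z :: "'v::real_normed_vector \<Rightarrow>\<^sub>L real"
  assumes l: "l > 0" and c: "\<And>x. c \<le> blinfun_apply z x + (norm x)\<^sup>2 / (2 * l)"
  shows "c \<le> - (l / 2 * (norm z)\<^sup>2)"
proof (cases "z = 0")
  case True
  then show ?thesis using c[of 0] by simp
next
  case False
  then have nz: "norm z > 0" by simp
  \<comment> \<open>Chosen so that \<open>norm z \<le> B\<close> rearranges to the claim.\<close>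
  define B where "B = (l / 2 * (norm z)\<^sup>2 - c) / (l * norm z)"
  have *: "- blinfun_apply z x \<le> B * norm x" for x
  proof (cases "x = 0")
    case False
    define s where "s = l * norm z / norm x"
    have s: "s > 0" using False nz l by (simp add: s_def)
    have "c \<le> s * blinfun_apply z x + (s * norm x)\<^sup>2 / (2 * l)"
      using c[of "s *\<^sub>R x"] s by (simp add: blinfun.bilinear_simps)
    also have "s * norm x = l * norm z" using False by (simp add: s_def)
    also have "(l * norm z)\<^sup>2 / (2 * l) = l / 2 * (norm z)\<^sup>2"
      using l by (simp add: power2_eq_square)
    finally have "s * (- blinfun_apply z x) \<le> l / 2 * (norm z)\<^sup>2 - c" by simp
    then show ?thesis
      using False nz l by (simp add: s_def B_def field_simps)
  qed simp
  have "0 \<le> B * norm x" for x :: 'v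
    using *[of x] *[of "- x"] by (simp add: blinfun.minus_right)
  moreover obtain x where "blinfun_apply z x \<noteq> 0"
    using False by (metis blinfun_eqI zero_blinfun.rep_eq)
  then have "norm x > 0" by auto
  ultimately have "B \<ge> 0" by (metis zero_le_mult_iff not_le)
  then have "norm z \<le> B"
    using *[of "- _"] * by (intro norm_blinfun_bound) (auto simp: abs_le_iff blinfun.minus_right)
  then show ?thesis using nz l by (simp add: B_def field_simps power2_eq_square)
qed

lemma blinfun_prod_decompose:
  fixes f :: "('v::real_normed_vector \<times> 'w::real_normed_vector) \<Rightarrow>\<^sub>L real"
  obtains g :: "'v \<Rightarrow>\<^sub>L real" and h :: "'w \<Rightarrow>\<^sub>L real"
  where "\<And>x y. blinfun_apply f (x, y) = blinfun_apply g x + blinfun_apply h y"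
proof -
  have g: "bounded_linear (\<lambda>x. blinfun_apply f (x, 0))"
    by (intro bounded_linear_compose[OF blinfun.bounded_linear_right] bounded_linear_Pair
        bounded_linear_ident bounded_linear_zero)
  have h: "bounded_linear (\<lambda>y. blinfun_apply f (0, y))"
    by (intro bounded_linear_compose[OF blinfun.bounded_linear_right] bounded_linear_Pair
        bounded_linear_ident bounded_linear_zero)
  show ?thesis
  proof (rule that)
    show "blinfun_apply f (x, y) = blinfun_apply (Blinfun (\<lambda>x. blinfun_apply f (x, 0))) x +
        blinfun_apply (Blinfun (\<lambda>y. blinfun_apply f (0, y))) y" for x y
      unfolding bounded_linear_Blinfun_apply[OF g] bounded_linear_Blinfun_apply[OF h]
      by (simp flip: blinfun.add_right)
  qed
qed

lemma blinfun_real_apply: "blinfun_apply (f :: real \<Rightarrow>\<^sub>L real) r = blinfun_apply f 1 * r"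
  using blinfun.scaleR_right[of f r 1] by simp

lemma convex_combination_norm_square_le:
  fixes x y :: "'v::real_normed_vector"
  assumes "0 \<le> u" "0 \<le> v" "u + v = 1"
  shows "(norm (u *\<^sub>R x + v *\<^sub>R y))\<^sup>2 \<le> u * (norm x)\<^sup>2 + v * (norm y)\<^sup>2"
proof -
  have "norm (u *\<^sub>R x + v *\<^sub>R y) \<le> u * norm x + v * norm y"
    using norm_triangle_ineq[of "u *\<^sub>R x" "v *\<^sub>R y"] assms by simp
  then have "(norm (u *\<^sub>R x + v *\<^sub>R y))\<^sup>2 \<le> (u * norm x + v * norm y)\<^sup>2"
    by (intro power_mono) auto
  also have "\<dots> = u * (norm x)\<^sup>2 + v * (norm y)\<^sup>2 - u * v * (norm x - norm y)\<^sup>2"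
  proof -
    have v: "v = 1 - u" using assms by simp
    show ?thesis unfolding v by (simp add: power2_eq_square algebra_simps)
  qed
  also have "\<dots> \<le> u * (norm x)\<^sup>2 + v * (norm y)\<^sup>2"
    using assms by simp
  finally show ?thesis .
qed

lemma le_young:
  fixes a b l :: real
  assumes "l > 0"
  shows "a * b \<le> a\<^sup>2 / (2 * l) + l / 2 * b\<^sup>2"
proof -
  have "0 \<le> (a - l * b)\<^sup>2 / (2 * l)" using assms by simp
  also have "\<dots> = a\<^sup>2 / (2 * l) + l / 2 * b\<^sup>2 - a * b"
    using assms by (simp add: power2_eq_square field_simps)
  finally show ?thesis by simp
qed

section \<open>The convex hull of the graph\<close>

lemma monotone_set_insert:
  assumes G: "monotone_set G"
    and rel: "\<And>a a'. (a, a') \<in> G \<Longrightarrow> 0 \<le> blinfun_apply (x' - a') (x - a)"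
  shows "monotone_set (insert (x, x') G)"
  unfolding monotone_set_def
proof (intro ballI, clarify)
  fix y y' z z' assume yz: "(y, y') \<in> insert (x, x') G" "(z, z') \<in> insert (x, x') G"
  have flip: "blinfun_apply (y' - x') (y - x) = blinfun_apply (x' - y') (x - y)"
    by (simp add: blinfun.bilinear_simps)
  consider "(y, y') = (x, x')" "(z, z') = (x, x')" | "(y, y') = (x, x')" "(z, z') \<in> G" |
    "(y, y') \<in> G" "(z, z') = (x, x')" | "(y, y') \<in> G" "(z, z') \<in> G"
    using yz by blast
  then show "0 \<le> blinfun_apply (y' - z') (y - z)"
  proof cases
    case 3
    then show ?thesis using rel[of y y'] flip by simp
  next
    case 4
    then show ?thesis using G unfolding monotone_set_def by blast
  qed (use rel in auto)
qed

lemma gra_memI_monotone: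
  assumes A: "maximally_monotone A"
    and rel: "\<And>a a'. (a, a') \<in> gra A \<Longrightarrow> 0 \<le> blinfun_apply (x' - a') (x - a)"
  shows "(x, x') \<in> gra A"
proof -
  have "monotone_set (insert (x, x') (gra A))"
    using A rel by (intro monotone_set_insert) (auto simp: maximally_monotone_def)
  moreover have "\<not> (monotone_set G \<and> gra A \<subset> G)" for G
    using A unfolding maximally_monotone_def by blast
  ultimately show ?thesis by blast
qed

lemma gra_nonempty:
  assumes "maximally_monotone A"
  shows "gra A \<noteq> {}"
  using gra_memI_monotone[OF assms] by blast

lemma type_NI_le:
  assumes "type_NI A"
    and "\<And>a a'. (a, a') \<in> gra A \<Longrightarrow>
      blinfun_apply z' a + blinfun_apply z'' a' - blinfun_apply a' a \<le> b"
  shows "blinfun_apply z'' z' \<le> b"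
proof -
  have "ereal (blinfun_apply z'' z') \<le> (SUP (a, a') \<in> gra A.
      ereal (blinfun_apply z' a + blinfun_apply z'' a' - blinfun_apply a' a))"
    using assms(1) unfolding type_NI_def by blast
  also have "\<dots> \<le> ereal b"
    using assms(2) by (auto intro!: SUP_least)
  finally show ?thesis by simp
qed

text \<open>
  Its lower envelope in the last coordinate is the largest convex function that is at most the
  duality pairing on \<open>G\<close>.
\<close>

definition graph_hull :: "('a::real_normed_vector \<times> 'a dual) set \<Rightarrow> ('a \<times> 'a dual \<times> real) set" where
  "graph_hull G = convex hull ((\<lambda>(a, a'). (a, a', blinfun_apply a' a)) ` G)"

lemma convex_graph_hull: "convex (graph_hull G)"
  by (simp add: graph_hull_def)

lemma graph_hullI: "(a, a') \<in> G \<Longrightarrow> (a, a', blinfun_apply a' a) \<in> graph_hull G"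
  unfolding graph_hull_def by (rule hull_inc) force

text \<open>For fixed \<open>(b, b')\<close> the inequality is affine in \<open>(x, x', r)\<close>
  and holds at the generators by monotonicity. The supremum of the left side over
  \<open>(b, b')\<close> is the Fitzpatrick function.\<close>

lemma graph_hull_ge:
  assumes "monotone_set G" "(b, b') \<in> G" "(x, x', r) \<in> graph_hull G"
  shows "blinfun_apply b' x + blinfun_apply x' b - blinfun_apply b' b \<le> r"
proof -
  let ?S = "{(x, x', r). blinfun_apply b' x + blinfun_apply x' b - blinfun_apply b' b \<le> r}"
  have "graph_hull G \<subseteq> ?S"
    unfolding graph_hull_def
  proof (rule hull_minimal)
    have "0 \<le> blinfun_apply (a' - b') (a - b)" if "(a, a') \<in> G" for a a'
      using assms that unfolding monotone_set_def by fastforce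
    then show "(\<lambda>(a, a'). (a, a', blinfun_apply a' a)) ` G \<subseteq> ?S"
      by (force simp: blinfun.bilinear_simps)
    show "convex ?S"
    proof (rule convexI, clarsimp)
      fix x x' r y y' s and u v :: real
      assume *: "blinfun_apply b' x + blinfun_apply x' b - blinfun_apply b' b \<le> r"
        "blinfun_apply b' y + blinfun_apply y' b - blinfun_apply b' b \<le> s"
        and uv: "0 \<le> u" "0 \<le> v" "u + v = 1"
      have "u * (blinfun_apply b' x + blinfun_apply x' b - blinfun_apply b' b) +
          v * (blinfun_apply b' y + blinfun_apply y' b - blinfun_apply b' b) \<le> u * r + v * s"
        using * uv by (intro add_mono mult_left_mono)
      moreover have "blinfun_apply b' b = (u + v) * blinfun_apply b' b" using uv by simp
      ultimately show "blinfun_apply b' (u *\<^sub>R x + v *\<^sub>R y) +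
          blinfun_apply (u *\<^sub>R x' + v *\<^sub>R y') b - blinfun_apply b' b \<le> u * r + v * s"
        by (simp add: blinfun.bilinear_simps algebra_simps)
    qed
  qed
  then show ?thesis using assms(3) by blast
qed

text \<open>If \<open>r\<close> were smaller, \<open>graph_hull_ge\<close> would relate
  \<open>(x, x')\<close> monotonically to the graph. By maximality it would be a graph point, and
  \<open>graph_hull_ge\<close> at that very point gives the inequality after all.\<close>

lemma graph_hull_ge_pairing:
  assumes A: "maximally_monotone A" and x: "(x, x', r) \<in> graph_hull (gra A)"
  shows "blinfun_apply x' x \<le> r"
proof (rule ccontr)
  assume r: "\<not> blinfun_apply x' x \<le> r"
  have mono: "monotone_set (gra A)" using A by (simp add: maximally_monotone_def)
  have "(x, x') \<in> gra A"
  proof (rule gra_memI_monotone[OF A])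
    fix a a' assume "(a, a') \<in> gra A"
    from graph_hull_ge[OF mono this x] r show "0 \<le> blinfun_apply (x' - a') (x - a)"
      by (simp add: blinfun.bilinear_simps)
  qed
  from graph_hull_ge[OF mono this x] r show False by simp
qed

text \<open>By \<open>graph_hull_ge\<close>, a hull point with gap at most \<open>e\<close>
  satisfies \<open>(y' - a') (y - a) \<ge> - e\<close> against every graph point; the limit is
  monotonically related to the graph.\<close>

lemma gra_memI_graph_hull:
  assumes A: "maximally_monotone A"
    and approx: "\<And>e. e > 0 \<Longrightarrow> \<exists>y y' r. (y, y', r) \<in> graph_hull (gra A) \<and>
      norm (y - x) \<le> e \<and> norm (y' - x') \<le> e \<and> r - blinfun_apply y' y \<le> e"
  shows "(x, x') \<in> gra A"
proof (rule gra_memI_monotone[OF A])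
  fix a a' assume a: "(a, a') \<in> gra A"
  have mono: "monotone_set (gra A)" using A by (simp add: maximally_monotone_def)
  have "\<forall>n. \<exists>y y' r. (y, y', r) \<in> graph_hull (gra A) \<and>
      norm (y - x) \<le> 1 / real (Suc n) \<and> norm (y' - x') \<le> 1 / real (Suc n) \<and>
      r - blinfun_apply y' y \<le> 1 / real (Suc n)"
    using approx by simp
  then obtain y y' r where y: "\<And>n. (y n, y' n, r n) \<in> graph_hull (gra A)"
    "\<And>n. norm (y n - x) \<le> 1 / real (Suc n)" "\<And>n. norm (y' n - x') \<le> 1 / real (Suc n)"
    "\<And>n. r n - blinfun_apply (y' n) (y n) \<le> 1 / real (Suc n)"
    by metis
  have lim0: "(\<lambda>n. 1 / real (Suc n)) \<longlonglongrightarrow> 0"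
    using LIMSEQ_Suc[OF lim_1_over_n] by simp
  have "(\<lambda>n. y n - x) \<longlonglongrightarrow> 0" "(\<lambda>n. y' n - x') \<longlonglongrightarrow> 0"
    by (rule Lim_null_comparison[OF always_eventually lim0], use y in blast)+
  then have lim: "y \<longlonglongrightarrow> x" "y' \<longlonglongrightarrow> x'"
    by (simp_all add: LIM_zero_iff)
  have ge: "- (1 / real (Suc n)) \<le> blinfun_apply (y' n - a') (y n - a)" for n
    using graph_hull_ge[OF mono a y(1), of n] y(4)[of n] by (simp add: blinfun.bilinear_simps)
  have "- 0 \<le> blinfun_apply (x' - a') (x - a)"
  proof (rule LIMSEQ_le)
    show "(\<lambda>n. - (1 / real (Suc n))) \<longlonglongrightarrow> - 0" by (intro tendsto_minus lim0)
    show "(\<lambda>n. blinfun_apply (y' n - a') (y n - a)) \<longlonglongrightarrow> blinfun_apply (x' - a') (x - a)"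
      by (intro blinfun.tendsto tendsto_diff lim tendsto_const)
  qed (use ge in blast)
  then show "0 \<le> blinfun_apply (x' - a') (x - a)" by simp
qed

section \<open>Consequences of (NI): a regularised problem and a Brondsted-Rockafellar
  property\<close>

text \<open>With \<open>v = x - x0\<close> and \<open>v' = x' - x0'\<close>, the penalty is a convex
  function of \<open>v\<close>, namely the quadratic plus the hinge
  \<open>max 0 (- y' v - 1)\<close>, together with its conjugate at \<open>- v'\<close>; that
  conjugate is the infimum over \<open>s\<close> in \<open>{0..1}\<close> of the last two terms.
  (NI) makes the infimum of the whole expression at most 0, hence below any
  \<open>h > 0\<close>.\<close>

lemma type_NI_regularized:
  fixes A :: "'a::real_normed_vector \<Rightarrow> 'a dual set"
  assumes NI: "type_NI A" and ne: "gra A \<noteq> {}" and l: "l > 0" and h: "h > 0"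
  obtains x x' r s where "(x, x', r) \<in> graph_hull (gra A)" "0 \<le> s" "s \<le> 1"
    "r - blinfun_apply x0' x - blinfun_apply x' x0 + blinfun_apply x0' x0 +
      max 0 (- blinfun_apply y' (x - x0) - 1) + (norm (x - x0))\<^sup>2 / (2 * l) +
      l / 2 * (norm (x' - x0' - s *\<^sub>R y'))\<^sup>2 + s < h"
proof (rule ccontr)
  assume neg: "\<not> thesis"
  \<comment> \<open>Everything is recentred at \<open>(x0, x0')\<close>. Giving
    \<open>y' (x - x0)\<close> its own coordinate makes the separating functional deliver a
    multiplier \<open>S\<close> for the hinge.\<close>
  define \<Phi> where "\<Phi> = (\<lambda>(x, x', r). (x - x0, blinfun_apply y' (x - x0), x' - x0',
    r - blinfun_apply x0' x - blinfun_apply x' x0 + blinfun_apply x0' x0))"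
  define k :: "'a \<Rightarrow> real \<Rightarrow> 'a dual \<Rightarrow> real \<Rightarrow> real" where "k = (\<lambda>x \<rho> x' s. max 0 (- \<rho> - 1) + (norm x)\<^sup>2 / (2 * l) +
      l / 2 * (norm (x' - s *\<^sub>R y'))\<^sup>2 + s)"
  define D where "D = (\<Union>s\<in>{0..1}. {(x, \<rho>, x', r). r + k x \<rho> x' s < h})"
  define C where "C = \<Phi> ` graph_hull (gra A)"
  have disj: "C \<inter> D = {}"
    using neg that by (force simp: C_def D_def \<Phi>_def k_def algebra_simps)
  have D_open: "open D"
    unfolding D_def k_def case_prod_unfold
    by (intro open_UN ballI open_Collect_less continuous_intros) (use l in auto)
  have D_convex: "convex D"
  proof (rule convexI)
    fix p q and u v :: real
    assume pq: "p \<in> D" "q \<in> D" and uv: "0 \<le> u" "0 \<le> v" "u + v = 1"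
    obtain x \<rho> x' r s where p: "p = (x, \<rho>, x', r)" "s \<in> {0..1}" "r + k x \<rho> x' s < h"
      using pq(1) by (auto simp: D_def)
    obtain y \<sigma> z' t w where q: "q = (y, \<sigma>, z', t)" "w \<in> {0..1}" "t + k y \<sigma> z' w < h"
      using pq(2) by (auto simp: D_def)
    have 1: "max 0 (- (u * \<rho> + v * \<sigma>) - 1) \<le> u * max 0 (- \<rho> - 1) + v * max 0 (- \<sigma> - 1)"
    proof -
      have "u * (- \<rho> - 1) + v * (- \<sigma> - 1) \<le> u * max 0 (- \<rho> - 1) + v * max 0 (- \<sigma> - 1)"
        using uv by (intro add_mono mult_left_mono) auto
      moreover have "u * (- \<rho> - 1) + v * (- \<sigma> - 1) = - (u * \<rho> + v * \<sigma>) - (u + v)"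
        by (simp add: algebra_simps)
      ultimately show ?thesis using uv by simp
    qed
    have 2: "(norm (u *\<^sub>R x + v *\<^sub>R y))\<^sup>2 / (2 * l) \<le> u * ((norm x)\<^sup>2 / (2 * l)) + v * ((norm y)\<^sup>2 / (2 * l))"
      using divide_right_mono[OF convex_combination_norm_square_le[OF uv, of x y], of "2 * l"] l
      by (simp add: add_divide_distrib)
    have "u *\<^sub>R x' + v *\<^sub>R z' - (u * s + v * w) *\<^sub>R y' =
        u *\<^sub>R (x' - s *\<^sub>R y') + v *\<^sub>R (z' - w *\<^sub>R y')"
      by (simp add: algebra_simps)
    then have 3: "l / 2 * (norm (u *\<^sub>R x' + v *\<^sub>R z' - (u * s + v * w) *\<^sub>R y'))\<^sup>2 \<le>
        u * (l / 2 * (norm (x' - s *\<^sub>R y'))\<^sup>2) + v * (l / 2 * (norm (z' - w *\<^sub>R y'))\<^sup>2)"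
      using mult_left_mono[OF convex_combination_norm_square_le[OF uv,
            of "x' - s *\<^sub>R y'" "z' - w *\<^sub>R y'"], of "l / 2"] l
      by (simp add: algebra_simps)
    have "u * r + v * t + k (u *\<^sub>R x + v *\<^sub>R y) (u * \<rho> + v * \<sigma>) (u *\<^sub>R x' + v *\<^sub>R z') (u * s + v * w)
        \<le> u * (r + k x \<rho> x' s) + v * (t + k y \<sigma> z' w)"
      unfolding k_def using 1 2 3 by (simp only: distrib_left)
    also have "\<dots> < h"
      by (rule convex_bound_lt[OF p(3) q(3) uv])
    finally have "u * r + v * t + k (u *\<^sub>R x + v *\<^sub>R y) (u * \<rho> + v * \<sigma>) (u *\<^sub>R x' + v *\<^sub>R z') (u * s + v * w) < h" .
    moreover have "u * s + v * w \<in> {0..1}"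
      using p(2) q(2) uv convex_bound_le[of s 1 w u v] by auto
    ultimately show "u *\<^sub>R p + v *\<^sub>R q \<in> D"
      unfolding D_def p(1) q(1) by (auto intro!: bexI[of _ "u * s + v * w"])
  qed
  have "(0, 0, 0, 0) \<in> D"
    using h by (auto simp: D_def k_def intro!: bexI[of _ 0])
  then have D_ne: "D \<noteq> {}" by blast
  have C_convex: "convex C"
  proof (rule convexI)
    fix p q and u v :: real
    assume pq: "p \<in> C" "q \<in> C" and uv: "0 \<le> u" "0 \<le> v" "u + v = 1"
    obtain x x' r where p: "p = \<Phi> (x, x', r)" "(x, x', r) \<in> graph_hull (gra A)"
      using pq(1) by (auto simp: C_def)
    obtain y z' t where q: "q = \<Phi> (y, z', t)" "(y, z', t) \<in> graph_hull (gra A)"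
      using pq(2) by (auto simp: C_def)
    have v: "v = 1 - u" using uv by simp
    have "u *\<^sub>R p + v *\<^sub>R q = \<Phi> (u *\<^sub>R (x, x', r) + v *\<^sub>R (y, z', t))"
      unfolding v by (simp add: p q \<Phi>_def blinfun.bilinear_simps algebra_simps)
    then show "u *\<^sub>R p + v *\<^sub>R q \<in> C"
      using convexD[OF convex_graph_hull p(2) q(2) uv] by (auto simp: C_def)
  qed
  obtain a a' where a: "(a, a') \<in> gra A" using ne by auto
  then have aC: "\<Phi> (a, a', blinfun_apply a' a) \<in> C"
    by (auto simp: C_def intro: graph_hullI)
  obtain f :: "('a \<times> real \<times> 'a dual \<times> real) \<Rightarrow>\<^sub>L real" and b where fC: "\<And>p. p \<in> C \<Longrightarrow> blinfun_apply f p \<le> b"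
    and fD: "\<And>p. p \<in> D \<Longrightarrow> b < blinfun_apply f p"
    using separating_functional_open[OF C_convex _ D_open D_convex D_ne disj] aC by blast
  obtain z f1 where f1: "\<And>x y. blinfun_apply f (x, y) = blinfun_apply z x + blinfun_apply f1 y"
    using blinfun_prod_decompose by blast
  obtain f2 f3 where f2: "\<And>x y. blinfun_apply f1 (x, y) = blinfun_apply f2 x + blinfun_apply f3 y"
    using blinfun_prod_decompose by blast
  obtain z'' f4 where f3: "\<And>x y. blinfun_apply f3 (x, y) = blinfun_apply z'' x + blinfun_apply f4 y"
    using blinfun_prod_decompose by blast
  define \<sigma> where "\<sigma> = blinfun_apply f2 1"
  define \<tau> where "\<tau> = - blinfun_apply f4 1"
  have f: "blinfun_apply f (x, \<rho>, x', r) = blinfun_apply z x + \<sigma> * \<rho> + blinfun_apply z'' x' - \<tau> * r"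
    for x \<rho> x' r
    by (simp add: f1 f2 f3 \<sigma>_def \<tau>_def blinfun_real_apply[of f2 \<rho>] blinfun_real_apply[of f4 r])
  \<comment> \<open>Lowering the last coordinate moves the image of a graph point from
    \<open>C\<close> into \<open>D\<close>, so the functional must strictly increase. Afterwards
    everything is divided by \<open>\<tau>\<close>.\<close>
  have \<tau>: "\<tau> > 0"
  proof -
    obtain x \<rho> x' r where p: "\<Phi> (a, a', blinfun_apply a' a) = (x, \<rho>, x', r)"
      using prod_cases4 by blast
    define N where "N = \<bar>r + k x \<rho> x' 0 - h\<bar> + 1"
    have "(x, \<rho>, x', r - N) \<in> D"
      unfolding D_def N_def by (auto intro!: bexI[of _ 0])
    from fD[OF this] fC[OF aC] have "\<tau> * N > 0" by (simp add: p f algebra_simps)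
    moreover have "N > 0" by (simp add: N_def)
    ultimately show ?thesis by (simp add: zero_less_mult_iff)
  qed
  define Z where "Z = (1 / \<tau>) *\<^sub>R z"
  define Z'' where "Z'' = (1 / \<tau>) *\<^sub>R z''"
  define S where "S = \<sigma> / \<tau>"
  define B where "B = b / \<tau>"
  have BD: "B \<le> blinfun_apply Z x + S * \<rho> + blinfun_apply Z'' x' + k x \<rho> x' s - h"
    if s: "0 \<le> s" "s \<le> 1" for x \<rho> x' s
  proof (rule field_le_epsilon)
    fix e :: real assume e: "e > 0"
    have "(x, \<rho>, x', h - k x \<rho> x' s - e) \<in> D"
      unfolding D_def using s e by (auto intro!: bexI[of _ s])
    from fD[OF this] have "b < blinfun_apply z x + \<sigma> * \<rho> + blinfun_apply z'' x' - \<tau> * (h - k x \<rho> x' s - e)"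
      by (simp add: f)
    then have "b / \<tau> < (blinfun_apply z x + \<sigma> * \<rho> + blinfun_apply z'' x' - \<tau> * (h - k x \<rho> x' s - e)) / \<tau>"
      using \<tau> by (intro divide_strict_right_mono)
    then show "B \<le> blinfun_apply Z x + S * \<rho> + blinfun_apply Z'' x' + k x \<rho> x' s - h + e"
      using \<tau> by (simp add: B_def Z_def S_def Z''_def blinfun.bilinear_simps add_divide_distrib diff_divide_distrib)
  qed
  have BC: "blinfun_apply Z (a - x0) + S * blinfun_apply y' (a - x0) + blinfun_apply Z'' (a' - x0')
      - blinfun_apply (a' - x0') (a - x0) \<le> B" if "(a, a') \<in> gra A" for a a'
  proof -
    have "\<Phi> (a, a', blinfun_apply a' a) \<in> C"
      using that by (auto simp: C_def intro: graph_hullI)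
    from divide_right_mono[OF fC[OF this], of \<tau>] show ?thesis
      using \<tau> by (simp add: \<Phi>_def f B_def Z_def S_def Z''_def blinfun.bilinear_simps
          add_divide_distrib diff_divide_distrib)
  qed
  \<comment> \<open>Letting \<open>\<rho>\<close> tend to plus and minus infinity here forces
    \<open>0 \<le> S\<close> and \<open>S \<le> 1\<close>, so \<open>S\<close> is an admissible
    value of \<open>s\<close>.\<close>
  have bound: "B + h \<le> S * \<rho> + max 0 (- \<rho> - 1)" for \<rho>
    using BD[of 0 0 \<rho> 0] by (simp add: k_def)
  have S0: "S \<ge> 0"
  proof (rule ccontr)
    assume "\<not> S \<ge> 0"
    with bound[of "(\<bar>B + h\<bar> + 1) / (- S)"] show False by (simp add: max_def divide_simps split: if_splits)
  qed
  have S1: "S \<le> 1"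
  proof (rule ccontr)
    assume S: "\<not> S \<le> 1"
    define \<rho> where "\<rho> = - 1 - (\<bar>B + h\<bar> + 1) / (S - 1)"
    have "(\<bar>B + h\<bar> + 1) / (S - 1) > 0" using S by (simp add: add_nonneg_pos)
    then have "B + h \<le> S * \<rho> - \<rho> - 1" using bound[of \<rho>] by (simp add: \<rho>_def max_def)
    also have "\<dots> = (S - 1) * \<rho> - 1" by (simp add: algebra_simps)
    also have "\<dots> = - (S - 1) - (\<bar>B + h\<bar> + 1) - 1" using S by (simp add: \<rho>_def right_diff_distrib)
    finally show False using S by linarith
  qed
  \<comment> \<open>The choices are \<open>s = S\<close>, \<open>\<rho> = - 1\<close> at the kink of
    the hinge, and a dual component leaving \<open>Z\<close> inside the norm. The infimum over
    \<open>x\<close> then cancels the quadratic in \<open>Z\<close>, and the two \<open>S\<close>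
    cancel.\<close>
  have "B + h + S - blinfun_apply Z'' (Z + S *\<^sub>R y') - l / 2 * (norm Z)\<^sup>2 - S \<le>
      blinfun_apply Z x + (norm x)\<^sup>2 / (2 * l)" for x
    using BD[OF S0 S1, of x "- 1" "Z + S *\<^sub>R y'"] by (simp add: k_def)
  from inf_linear_plus_square[OF l this]
  have le: "B \<le> blinfun_apply Z'' (Z + S *\<^sub>R y') - h" by simp
  define P where "P = blinfun_apply (Z + S *\<^sub>R y') x0 + blinfun_apply Z'' x0' + blinfun_apply x0' x0"
  \<comment> \<open>(NI) at the pair shifted back by \<open>(x0, x0')\<close>; \<open>P\<close>
    collects the terms created by the shift. This contradicts \<open>le\<close> by the margin
    \<open>h\<close>.\<close>
  have "blinfun_apply (Z'' + canonical_embedding x0) (Z + S *\<^sub>R y' + x0') \<le> B + P"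
  proof (rule type_NI_le[OF NI])
    fix a a' assume "(a, a') \<in> gra A"
    from BC[OF this] show "blinfun_apply (Z + S *\<^sub>R y' + x0') a +
        blinfun_apply (Z'' + canonical_embedding x0) a' - blinfun_apply a' a \<le> B + P"
      by (simp add: P_def blinfun.bilinear_simps algebra_simps)
  qed
  with le h show False by (simp add: P_def blinfun.bilinear_simps algebra_simps)
qed

lemma blinfun_apply_norm_bounds:
  fixes f :: "'v::real_normed_vector \<Rightarrow>\<^sub>L real"
  shows "blinfun_apply f x \<le> norm f * norm x" "- (norm f * norm x) \<le> blinfun_apply f x"
  using norm_blinfun[of f x] by auto

text \<open>One step of the iteration: \<open>type_NI_regularized\<close> with \<open>l = 1\<close>
  and \<open>y' = 0\<close>. The gap bound is Young's inequality; closeness to the old point comes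
  from convexity of the hull.\<close>

lemma graph_hull_improve:
  assumes A: "maximally_monotone A" and NI: "type_NI A" and e: "e > 0"
    and x0: "(x0, x0', r0) \<in> graph_hull (gra A)" "r0 - blinfun_apply x0' x0 < e\<^sup>2"
  obtains x x' r where "(x, x', r) \<in> graph_hull (gra A)" "r - blinfun_apply x' x < (e / 2)\<^sup>2"
    "norm (x - x0) \<le> 4 * e" "norm (x' - x0') \<le> 4 * e"
proof -
  obtain x x' r s where hull: "(x, x', r) \<in> graph_hull (gra A)" and s: "0 \<le> s"
    and *: "r - blinfun_apply x0' x - blinfun_apply x' x0 + blinfun_apply x0' x0 +
      max 0 (- blinfun_apply 0 (x - x0) - 1) + (norm (x - x0))\<^sup>2 / (2 * 1) +
      1 / 2 * (norm (x' - x0' - s *\<^sub>R 0))\<^sup>2 + s < (e / 2)\<^sup>2"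
    by (rule type_NI_regularized[OF NI gra_nonempty[OF A], of 1 "(e / 2)\<^sup>2" x0' x0 0])
      (use e in auto)
  define v where "v = x - x0"
  define v' where "v' = x' - x0'"
  have x: "x = x0 + v" "x' = x0' + v'" by (simp_all add: v_def v'_def)
  define c where "c = r - blinfun_apply x0' x - blinfun_apply x' x0 + blinfun_apply x0' x0"
  have c: "c + (norm v)\<^sup>2 / 2 + (norm v')\<^sup>2 / 2 < (e / 2)\<^sup>2"
    using * s by (simp add: c_def v_def v'_def)
  have young: "- ((norm v)\<^sup>2 / 2 + (norm v')\<^sup>2 / 2) \<le> blinfun_apply v' v"
    using blinfun_apply_norm_bounds(2)[of v' v] le_young[of 1 "norm v'" "norm v"] by simp
  have r: "r - blinfun_apply x' x = c - blinfun_apply v' v"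
    by (simp add: c_def x blinfun.bilinear_simps)
  \<comment> \<open>The gap at the midpoint of the old and the new point is also nonnegative. This
    bounds \<open>v' v\<close> above by the old gap and \<open>c\<close>, which turns the penalty
    bound into a bound on both norms.\<close>
  have "((1 / 2) *\<^sub>R x0 + (1 / 2) *\<^sub>R x, (1 / 2) *\<^sub>R x0' + (1 / 2) *\<^sub>R x', (1 / 2) * r0 + (1 / 2) * r)
      \<in> graph_hull (gra A)"
    using convexD[OF convex_graph_hull x0(1) hull, of "1 / 2" "1 / 2"] by simp
  from graph_hull_ge_pairing[OF A this]
  have "blinfun_apply v' v \<le> 2 * (r0 - blinfun_apply x0' x0) + 2 * c"
    by (simp add: c_def x blinfun.bilinear_simps field_simps)
  moreover have "c + (norm v)\<^sup>2 / 2 + (norm v')\<^sup>2 / 2 < e\<^sup>2 / 4"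
    using c by (simp add: power_divide)
  moreover have "S + T < 5 * q"
    if "p \<le> 2 * g + 2 * k" "k + S / 2 + T / 2 < q / 4" "- (S / 2 + T / 2) \<le> p" "g < q"
    for p g k S T q :: real
    using that by linarith
  ultimately have "(norm v)\<^sup>2 + (norm v')\<^sup>2 < 5 * e\<^sup>2"
    using young x0(2) by blast
  also have "\<dots> \<le> (4 * e)\<^sup>2" by (simp add: power2_eq_square)
  finally have "(norm v)\<^sup>2 \<le> (4 * e)\<^sup>2" "(norm v')\<^sup>2 \<le> (4 * e)\<^sup>2"
    using zero_le_power2[of "norm v"] zero_le_power2[of "norm v'"] by linarith+
  then have "norm v \<le> 4 * e" "norm v' \<le> 4 * e"
    using e by (auto intro: power2_le_imp_le)
  with that[OF hull] r young c show ?thesis by (auto simp: v_def v'_def)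
qed

lemma convergent_geometric_increments:
  fixes x :: "nat \<Rightarrow> 'v::banach"
  assumes "\<And>n. norm (x (Suc n) - x n) \<le> K / 2 ^ n"
  obtains l where "x \<longlonglongrightarrow> l" "norm (l - x 0) \<le> 2 * K"
proof -
  let ?d = "\<lambda>n. x (Suc n) - x n"
  have g: "(\<lambda>n. K / 2 ^ n) sums (2 * K)"
    using sums_mult[OF geometric_sums[of "1 / 2 :: real"], of K] by (simp add: power_one_over field_simps)
  have sum: "summable ?d"
    by (rule summable_comparison_test'[OF sums_summable[OF g]]) (rule assms)
  have "(\<lambda>n. \<Sum>i<n. ?d i) \<longlonglongrightarrow> suminf ?d" by (rule summable_LIMSEQ[OF sum])
  then have "(\<lambda>n. x n - x 0) \<longlonglongrightarrow> suminf ?d" by (simp add: sum_lessThan_telescope)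
  then have "x \<longlonglongrightarrow> suminf ?d + x 0" using tendsto_add[OF _ tendsto_const[of "x 0"]] by fastforce
  moreover have "norm (suminf ?d) \<le> suminf (\<lambda>n. K / 2 ^ n)"
    by (rule norm_suminf_le[OF assms sums_summable[OF g]])
  ultimately show ?thesis using that sums_unique[OF g] by simp
qed

text \<open>Iterating \<open>graph_hull_improve\<close> with \<open>e / 2 ^ n\<close> gives
  increments summing to \<open>8 * e\<close>, so both components converge by completeness; the gaps
  tend to 0 and the limit is a graph point.\<close>

lemma brondsted_rockafellar:
  fixes A :: "'a::banach \<Rightarrow> 'a dual set"
  assumes A: "maximally_monotone A" and NI: "type_NI A" and e: "e > 0"
    and x0: "(x0, x0', r0) \<in> graph_hull (gra A)" "r0 - blinfun_apply x0' x0 < e\<^sup>2"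
  obtains a a' where "(a, a') \<in> gra A" "norm (a - x0) \<le> 8 * e" "norm (a' - x0') \<le> 8 * e"
proof -
  \<comment> \<open>The last conjunct pins the start of the sequence, since dependent choice only
    guarantees \<open>P 0 (p 0)\<close>.\<close>
  define P where "P = (\<lambda>n (x, x', r). (x, x', r) \<in> graph_hull (gra A) \<and> r - blinfun_apply x' x < (e / 2 ^ n)\<^sup>2 \<and>
    (n = (0::nat) \<longrightarrow> x = x0 \<and> x' = x0'))"
  define Q where "Q = (\<lambda>n (x :: 'a, x' :: 'a dual, r :: real) (y, y', s :: real).
    norm (y - x) \<le> 4 * e / 2 ^ n \<and> norm (y' - x') \<le> 4 * e / 2 ^ n)"
  have step: "\<exists>q. P (Suc n) q \<and> Q n p q" if p: "P n p" for n p
  proof -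
    obtain x x' r where x: "p = (x, x', r)" by (metis prod_cases3)
    have hull: "(x, x', r) \<in> graph_hull (gra A)" "r - blinfun_apply x' x < (e / 2 ^ n)\<^sup>2"
      using p x by (auto simp: P_def)
    have "e / 2 ^ n > 0" using e by simp
    from graph_hull_improve[OF A NI this hull] obtain y y' s where
      "(y, y', s) \<in> graph_hull (gra A)" "s - blinfun_apply y' y < (e / 2 ^ n / 2)\<^sup>2"
      "norm (y - x) \<le> 4 * (e / 2 ^ n)" "norm (y' - x') \<le> 4 * (e / 2 ^ n)" .
    then show ?thesis
      by (intro exI[of _ "(y, y', s)"]) (auto simp: P_def Q_def x mult.commute)
  qed
  have "P 0 (x0, x0', r0)" using x0 by (simp add: P_def)
  then obtain p where p: "\<And>n. P n (p n)" "\<And>n. Q n (p n) (p (Suc n))"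
    using dependent_nat_choice[of P Q, OF exI step] by blast
  define X where "X n = fst (p n)" for n
  define X' where "X' n = fst (snd (p n))" for n
  define R where "R n = snd (snd (p n))" for n
  have hull: "(X n, X' n, R n) \<in> graph_hull (gra A)"
    and gap: "R n - blinfun_apply (X' n) (X n) < (e / 2 ^ n)\<^sup>2" for n
    using p(1)[of n] by (auto simp: P_def X_def X'_def R_def case_prod_unfold)
  have start: "X 0 = x0" "X' 0 = x0'"
    using p(1)[of 0] by (auto simp: P_def X_def X'_def case_prod_unfold)
  have inc: "norm (X (Suc n) - X n) \<le> 4 * e / 2 ^ n" "norm (X' (Suc n) - X' n) \<le> 4 * e / 2 ^ n" for n
    using p(2)[of n] by (auto simp: Q_def X_def X'_def case_prod_unfold)
  obtain a where a: "X \<longlonglongrightarrow> a" "norm (a - X 0) \<le> 2 * (4 * e)"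
    using convergent_geometric_increments[of X, OF inc(1)] by blast
  obtain a' where a': "X' \<longlonglongrightarrow> a'" "norm (a' - X' 0) \<le> 2 * (4 * e)"
    using convergent_geometric_increments[of X', OF inc(2)] by blast
  have lim: "(\<lambda>n. (e / 2 ^ n)\<^sup>2) \<longlonglongrightarrow> 0"
  proof -
    have "(\<lambda>n. e / 2 ^ n) \<longlonglongrightarrow> 0"
      by (rule LIMSEQ_divide_realpow_zero) simp
    from tendsto_power[OF this, of 2] show ?thesis by simp
  qed
  have "(a, a') \<in> gra A"
  proof (rule gra_memI_graph_hull[OF A])
    fix d :: real assume d: "d > 0"
    have "\<forall>\<^sub>F n in sequentially. norm (X n - a) < d" "\<forall>\<^sub>F n in sequentially. norm (X' n - a') < d"
      using a(1) a'(1) d by (auto simp: tendsto_iff dist_norm)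
    moreover have "\<forall>\<^sub>F n in sequentially. (e / 2 ^ n)\<^sup>2 < d"
      using order_tendstoD(2)[OF lim d] .
    ultimately have "\<forall>\<^sub>F n in sequentially. norm (X n - a) < d \<and> norm (X' n - a') < d \<and> (e / 2 ^ n)\<^sup>2 < d"
      by (intro eventually_conj)
    then obtain n where "norm (X n - a) < d" "norm (X' n - a') < d" "(e / 2 ^ n)\<^sup>2 < d"
      using eventually_happens'[OF sequentially_bot] by blast
    then show "\<exists>y y' r. (y, y', r) \<in> graph_hull (gra A) \<and> norm (y - a) \<le> d \<and>
        norm (y' - a') \<le> d \<and> r - blinfun_apply y' y \<le> d"
      using hull[of n] gap[of n] by (intro exI[of _ "X n"] exI[of _ "X' n"] exI[of _ "R n"]) linarith
  qed
  then show ?thesis using that a(2) a'(2) start by simp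
qed

section \<open>From (D) and from (FP) to (NI)\<close>

lemma type_NI_I:
  assumes "\<And>x'' x' c. c < blinfun_apply x'' x' \<Longrightarrow>
    (\<And>a a'. (a, a') \<in> gra A \<Longrightarrow>
      blinfun_apply x' a + blinfun_apply x'' a' - blinfun_apply a' a \<le> c) \<Longrightarrow> False"
  shows "type_NI A"
  unfolding type_NI_def
proof (intro allI, rule ccontr)
  fix x'' :: "'a bidual" and x' :: "'a dual"
  let ?S = "SUP (a, a') \<in> gra A.
      ereal (blinfun_apply x' a + blinfun_apply x'' a' - blinfun_apply a' a)"
  assume "\<not> ereal (blinfun_apply x'' x') \<le> ?S"
  then have "?S < ereal (blinfun_apply x'' x')" by (simp only: not_le)
  from ereal_dense2[OF this] obtain c where c: "?S < ereal c" "ereal c < ereal (blinfun_apply x'' x')"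
    by blast
  have "blinfun_apply x' a + blinfun_apply x'' a' - blinfun_apply a' a \<le> c" if "(a, a') \<in> gra A" for a a'
  proof -
    have "ereal (blinfun_apply x' a + blinfun_apply x'' a' - blinfun_apply a' a) \<le> ?S"
      using SUP_upper[OF that, of "\<lambda>(a, a'). ereal (blinfun_apply x' a + blinfun_apply x'' a' - blinfun_apply a' a)"]
      by simp
    also note c(1)
    finally show ?thesis by simp
  qed
  then show False using assms[of c x'' x'] c(2) by simp
qed

lemma norm_canonical_embedding_le: "norm (canonical_embedding x) \<le> norm x"
proof (rule norm_blinfun_bound)
  show "norm (blinfun_apply (canonical_embedding x) f) \<le> norm x * norm f" for f
    using norm_blinfun[of f x] by (simp add: mult.commute)
qed simp

text \<open>A violation of (NI) bounds the pairing in (D) below by some \<open>d > 0\<close> on the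
  whole graph. Along the bounded net supplied by (D) that pairing becomes small, because its dual
  factor tends to 0 in norm.\<close>

lemma type_D_imp_type_NI:
  assumes D: "type_D A"
  shows "type_NI A"
proof (rule type_NI_I)
  fix x'' :: "'a bidual" and x' :: "'a dual" and c
  assume c: "c < blinfun_apply x'' x'"
    and le: "\<And>a a'. (a, a') \<in> gra A \<Longrightarrow>
      blinfun_apply x' a + blinfun_apply x'' a' - blinfun_apply a' a \<le> c"
  define d where "d = blinfun_apply x'' x' - c"
  have d: "d > 0" using c by (simp add: d_def)
  have ge: "d \<le> blinfun_apply (canonical_embedding a - x'') (a' - x')" if "(a, a') \<in> gra A" for a a'
    using le[OF that] by (simp add: d_def blinfun.bilinear_simps)
  have "0 \<le> (INF (a, a') \<in> gra A. ereal (blinfun_apply (canonical_embedding a - x'') (a' - x')))"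
    using ge d by (force intro!: INF_greatest)
  then obtain \<Gamma> :: "('a bidual \<times> 'a dual) set set" and le z
    where net: "bounded_net_limit (gra A) \<Gamma> le z (x'', x')"
    using D unfolding type_D_def by blast
  then have dir: "directed_set \<Gamma> le" and sub: "z ` \<Gamma> \<subseteq> gra A" and bdd: "bounded (z ` \<Gamma>)"
    and lim: "limitin euclidean (\<lambda>i. snd (z i)) x' (net_filter \<Gamma> le)"
    unfolding bounded_net_limit_def by (auto simp: limitin_pairwise o_def)
  from bdd obtain B where B: "\<And>i. i \<in> \<Gamma> \<Longrightarrow> norm (z i) \<le> B" "B > 0"
    unfolding bounded_pos by blast
  define k where "k = B + norm x''"
  have k: "k > 0" using B(2) by (simp add: k_def add_pos_nonneg)
  have "\<forall>\<^sub>F i in net_filter \<Gamma> le. dist (snd (z i)) x' < d / k"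
    using lim d k by (auto intro!: tendstoD)
  then obtain i where i: "i \<in> \<Gamma>" "dist (snd (z i)) x' < d / k"
    using dir unfolding eventually_net_filter[OF dir] directed_set_def by blast
  obtain a a' where a: "z i = (a, a')" by fastforce
  then have "(a, a') \<in> gra A" using sub i(1) by force
  from ge[OF this] have "d \<le> norm (canonical_embedding a - x'') * norm (a' - x')"
    using blinfun_apply_norm_bounds(1) order_trans by blast
  also have "\<dots> \<le> k * norm (a' - x')"
  proof (intro mult_right_mono norm_ge_zero)
    have "norm a \<le> B" using B(1)[OF i(1)] norm_fst_le[of a a'] by (simp add: a)
    then show "norm (canonical_embedding a - x'') \<le> k"
      using norm_triangle_ineq4[of "canonical_embedding a" x''] norm_canonical_embedding_le[of a]
      unfolding k_def by linarith
  qed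
  also have "\<dots> < d"
    using i(2) k by (simp add: a dist_norm field_simps)
  finally show False by simp
qed

lemma type_FP_imp_type_NI:
  assumes A: "maximally_monotone A" and FP: "type_FP A"
  shows "type_NI A"
proof (rule type_NI_I)
  fix x'' :: "'a bidual" and x' :: "'a dual" and c
  assume c: "c < blinfun_apply x'' x'"
    and le: "\<And>a a'. (a, a') \<in> gra A \<Longrightarrow>
      blinfun_apply x' a + blinfun_apply x'' a' - blinfun_apply a' a \<le> c"
  define d where "d = blinfun_apply x'' x' - c"
  have d: "d > 0" using c by (simp add: d_def)
  have ge: "d \<le> blinfun_apply (canonical_embedding a - x'') (a' - x')" if "(a, a') \<in> gra A" for a a'
    using le[OF that] by (simp add: d_def blinfun.bilinear_simps)
  obtain a0 a0' where a0: "(a0, a0') \<in> gra A" using gra_nonempty[OF A] by auto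
  obtain x where x: "\<bar>blinfun_apply (a0' - x') x - blinfun_apply x'' (a0' - x')\<bar> < d / 2"
    using goldstine[of "{a0' - x'}" x'' "norm x'' + 1" "d / 2"] d by auto
  \<comment> \<open>Replacing \<open>x''\<close> by \<open>x\<close> changes the pairing by
    \<open>w (a' - x')\<close>. Along the segment this costs less than \<open>d / 2\<close> by the
    choice of \<open>x\<close>; the radius \<open>e\<close> is chosen so that the thickening costs
    at most another \<open>d / 2\<close>.\<close>
  define w where "w = x'' - canonical_embedding x"
  define e where "e = d / (2 * (norm w + 1))"
  have wpos: "norm w + 1 > 0" by (simp add: add_nonneg_pos)
  have e: "e > 0" using d wpos by (simp add: e_def)
  have we: "norm w * e \<le> d / 2" using d wpos by (simp add: e_def field_simps)
  define U where "U = (\<Union>y\<in>closed_segment x' a0'. \<Union>b\<in>ball 0 e. {y + b})"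
  have U: "open U" "convex U"
    unfolding U_def by (auto intro!: open_sums convex_sums)
  have "x' + 0 \<in> U" "a0' + 0 \<in> U" unfolding U_def using e by force+
  then have mem: "x' \<in> U" "a0' \<in> U" by simp_all
  have pos: "0 < blinfun_apply (x' - a') (x - a)" if a: "(a, a') \<in> gra A" and a'U: "a' \<in> U" for a a'
  proof -
    obtain u b where u: "0 \<le> u" "u \<le> 1" and b: "norm b < e"
      and a': "a' = (1 - u) *\<^sub>R x' + u *\<^sub>R a0' + b"
      using a'U by (auto simp: U_def in_segment)
    have 1: "\<bar>blinfun_apply w (a0' - x')\<bar> < d / 2"
      using x by (simp add: w_def blinfun.bilinear_simps abs_if split: if_splits)
    have "\<bar>u * blinfun_apply w (a0' - x')\<bar> \<le> \<bar>blinfun_apply w (a0' - x')\<bar>"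
      using u by (simp add: abs_mult mult_left_le_one_le)
    moreover have "\<bar>blinfun_apply w b\<bar> \<le> norm w * e"
      using norm_blinfun[of w b] b mult_left_mono[of "norm b" e "norm w"] by simp
    moreover have "a' - x' = u *\<^sub>R (a0' - x') + b" by (simp add: a' algebra_simps)
    then have "blinfun_apply w (a' - x') = u * blinfun_apply w (a0' - x') + blinfun_apply w b"
      by (simp only: blinfun.add_right blinfun.scaleR_right real_scaleR_def)
    ultimately have "\<bar>blinfun_apply w (a' - x')\<bar> < d" using 1 we by linarith
    moreover have "blinfun_apply (x' - a') (x - a) =
        blinfun_apply (canonical_embedding a - x'') (a' - x') + blinfun_apply w (a' - x')"
      by (simp add: w_def blinfun.bilinear_simps)
    ultimately show ?thesis using ge[OF a] by linarith
  qed
  have "monotone_set (gra A \<inter> UNIV \<times> U)"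
    using A unfolding maximally_monotone_def monotone_set_def by blast
  then have "monotonically_related (x, x') (gra A \<inter> UNIV \<times> U)"
    unfolding monotonically_related_def insert_is_Un[symmetric]
    by (intro monotone_set_insert) (auto intro: less_imp_le pos)
  moreover have "U \<inter> ran_op A \<noteq> {}"
    using mem(2) a0 by (auto simp: ran_op_def gra_def)
  ultimately have "(x, x') \<in> gra A"
    using FP U mem(1) unfolding type_FP_def by blast
  \<comment> \<open>As a graph point with \<open>x'\<close> in \<open>U\<close>,
    \<open>(x, x')\<close> would be strictly related to itself.\<close>
  from pos[OF this mem(1)] show False by simp
qed

section \<open>From (NI) to (D) and (FP)\<close>

lemma small_multiple_less:
  fixes d m :: real
  assumes "d > 0" "r > 0"
  obtains s where "0 < s" "s < r" "\<bar>s * m\<bar> < d"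
proof -
  define s where "s = min (r / 2) (d / (2 * (\<bar>m\<bar> + 1)))"
  have s: "0 < s" "s < r" using assms by (auto simp: s_def)
  have "s * \<bar>m\<bar> \<le> d / (2 * (\<bar>m\<bar> + 1)) * \<bar>m\<bar>"
    by (intro mult_right_mono) (auto simp: s_def)
  also have "\<dots> \<le> d / 2"
    using assms by (simp add: field_simps)
  also have "\<dots> < d" using assms by simp
  finally show ?thesis using that s by (simp add: abs_mult)
qed

text \<open>The set \<open>D\<close> below consists of the points wanted, so a failure separates it
  from the hull. The coefficient \<open>\<tau>\<close> of the last coordinate may have either sign,
  so the functional is not normalised; it is added as a small perturbation to
  \<open>(x'', x')\<close>, and the first-order term contradicts (NI).\<close>

lemma bidual_approximation:
  fixes A :: "'a::real_normed_vector \<Rightarrow> 'a dual set"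
  assumes A: "maximally_monotone A" and NI: "type_NI A" and F: "finite F" and e: "e > 0"
    and rel: "\<And>a a'. (a, a') \<in> gra A \<Longrightarrow>
      0 \<le> blinfun_apply (canonical_embedding a - x'') (a' - x')"
  obtains x y' r y where "(x, y', r) \<in> graph_hull (gra A)" "norm y < norm x'' + 1"
    "\<forall>\<phi>\<in>F. \<bar>blinfun_apply \<phi> y - blinfun_apply x'' \<phi>\<bar> < e"
    "norm (x - y) < e" "norm (y' - x') < e" "\<bar>r - blinfun_apply x'' x'\<bar> < e"
proof (rule ccontr)
  assume neg: "\<not> thesis"
  define p where "p = blinfun_apply x'' x'"
  define K where "K = {y. norm y < norm x'' + 1 \<and>
    (\<forall>\<phi>\<in>F. \<bar>blinfun_apply \<phi> y - blinfun_apply x'' \<phi>\<bar> < e)}"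
  define D where "D = (\<Union>q\<in>K \<times> {(x', p)}. \<Union>v\<in>ball 0 e. {q + v})"
  have memD: "(y, x', p) + v \<in> D" if "y \<in> K" "norm v < e" for y v
    unfolding D_def using that by (intro UN_I[of "(y, x', p)"] UN_I[of v]) auto
  have K_convex: "convex K"
  proof -
    have "convex {y. \<bar>blinfun_apply \<phi> y - c\<bar> < e}" for \<phi> :: "'a dual" and c
    proof -
      have "{y. \<bar>blinfun_apply \<phi> y - c\<bar> < e} = blinfun_apply \<phi> -` {c - e<..<c + e}" by auto
      then show ?thesis
        by (simp only:) (intro convex_linear_vimage bounded_linear.linear blinfun.bounded_linear_right
            convex_real_interval)
    qed
    moreover have "K = ball 0 (norm x'' + 1) \<inter>
        (\<Inter>\<phi>\<in>F. {y. \<bar>blinfun_apply \<phi> y - blinfun_apply x'' \<phi>\<bar> < e})"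
      by (auto simp: K_def)
    ultimately show ?thesis by (simp add: convex_Int convex_INT)
  qed
  have D: "open D" "convex D"
    unfolding D_def using K_convex by (auto intro!: open_sums convex_sums convex_Times)
  have M: "norm x'' < norm x'' + 1" by simp
  obtain y0 where "norm y0 < norm x'' + 1"
    "\<forall>\<phi>\<in>F. \<bar>blinfun_apply \<phi> y0 - blinfun_apply x'' \<phi>\<bar> < e"
    by (rule goldstine[OF F M e])
  then have "y0 \<in> K" by (simp add: K_def)
  then have d0: "(y0, x', p) + 0 \<in> D" using e by (intro memD) auto
  obtain a0 a0' where a0: "(a0, a0') \<in> gra A" using gra_nonempty[OF A] by auto
  have "graph_hull (gra A) \<inter> D = {}"
  proof (rule ccontr)
    assume "graph_hull (gra A) \<inter> D \<noteq> {}"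
    then obtain x y' r where hull: "(x, y', r) \<in> graph_hull (gra A)" and "(x, y', r) \<in> D"
      by auto
    then obtain y q where y: "y \<in> K" and q: "norm q < e" "(x, y', r) = (y, x', p) + q"
      by (auto simp: D_def)
    obtain v v' \<rho> where "q = (v, v', \<rho>)" by (rule prod_cases3)
    with q have v: "norm (v, v', \<rho>) < e" and eq: "x = y + v" "y' = x' + v'" "r = p + \<rho>"
      by auto
    have "norm v < e" "norm (v', \<rho>) < e"
      using v norm_fst_le[of v "(v', \<rho>)"] norm_snd_le[of "(v', \<rho>)" v] by linarith+
    then have "norm v < e" "norm v' < e" "\<bar>\<rho>\<bar> < e"
      using norm_fst_le[of v' \<rho>] norm_snd_le[of \<rho> v'] by auto
    then have "thesis"
      using y eq by (intro that[OF hull, of y]) (auto simp: K_def p_def)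
    with neg show False ..
  qed
  then obtain f :: "('a \<times> 'a dual \<times> real) \<Rightarrow>\<^sub>L real" and b
    where fC: "\<And>q. q \<in> graph_hull (gra A) \<Longrightarrow> blinfun_apply f q \<le> b"
    and fD: "\<And>q. q \<in> D \<Longrightarrow> b < blinfun_apply f q"
    using separating_functional_open[OF convex_graph_hull _ D] graph_hullI[OF a0] d0 by blast
  obtain z' f1 where f1: "\<And>x y. blinfun_apply f (x, y) = blinfun_apply z' x + blinfun_apply f1 y"
    using blinfun_prod_decompose by blast
  obtain z'' f2 where f2: "\<And>x y. blinfun_apply f1 (x, y) = blinfun_apply z'' x + blinfun_apply f2 y"
    using blinfun_prod_decompose by blast
  define \<tau> where "\<tau> = blinfun_apply f2 1"
  have f: "blinfun_apply f (x, y, r) = blinfun_apply z' x + blinfun_apply z'' y + \<tau> * r" for x y r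
    by (simp add: f1 f2 \<tau>_def blinfun_real_apply[of f2 r])
  \<comment> \<open>A small shift decreasing \<open>f\<close> stays within the thickening, which
    gives separation with a margin \<open>d\<close> on the unthickened set.\<close>
  obtain v where v: "norm v < e" "blinfun_apply f v < 0"
  proof -
    define w where "w = ((y0, x', p) + 0) - (a0, a0', blinfun_apply a0' a0)"
    have w: "blinfun_apply f w > 0"
      unfolding w_def blinfun.diff_right using fD[OF d0] fC[OF graph_hullI[OF a0]] by linarith
    obtain s where "0 < s" "\<bar>s * norm w\<bar> < e" using small_multiple_less[of e 1 "norm w"] e by auto
    with w show thesis
      by (intro that[of "- s *\<^sub>R w"]) (auto simp: blinfun.bilinear_simps)
  qed
  define d where "d = - blinfun_apply f v"
  have d: "d > 0" using v by (simp add: d_def)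
  \<comment> \<open>Goldstine with \<open>z'\<close> added to \<open>F\<close> lets the first term
    approach \<open>x'' z'\<close> while \<open>y\<close> stays in \<open>K\<close>.\<close>
  have low: "b + d \<le> blinfun_apply x'' z' + blinfun_apply z'' x' + \<tau> * p"
  proof (rule field_le_epsilon)
    fix h :: real assume h: "h > 0"
    obtain y where y: "norm y < norm x'' + 1"
      "\<forall>\<phi>\<in>insert z' F. \<bar>blinfun_apply \<phi> y - blinfun_apply x'' \<phi>\<bar> < min e h"
      by (rule goldstine[of "insert z' F" x'' "norm x'' + 1" "min e h"]) (use F e h in simp_all)
    then have "y \<in> K" by (auto simp: K_def)
    from fD[OF memD[OF this v(1)]] have "b + d < blinfun_apply f (y, x', p)"
      by (simp only: blinfun.add_right d_def)
    also have "\<dots> = blinfun_apply z' y + blinfun_apply z'' x' + \<tau> * p" by (rule f)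
    finally have "b + d < blinfun_apply z' y + blinfun_apply z'' x' + \<tau> * p" .
    moreover have "\<bar>blinfun_apply z' y - blinfun_apply x'' z'\<bar> < h" using y(2) by simp
    ultimately show "b + d \<le> blinfun_apply x'' z' + blinfun_apply z'' x' + \<tau> * p + h"
      by linarith
  qed
  text \<open>NI is now violated at \<open>(x'', x') + s \<cdot> (w'', w')\<close> for small \<open>s > 0\<close>.\<close>
  define w' where "w' = z' + \<tau> *\<^sub>R x'"
  define w'' where "w'' = z'' + \<tau> *\<^sub>R x''"
  \<comment> \<open>The first bound on \<open>s\<close> keeps the weight
    \<open>1 + s * \<tau>\<close> nonnegative; the second makes the second-order term smaller than
    the margin.\<close>
  obtain s where s: "0 < s" "s < 1 / (\<bar>\<tau>\<bar> + 1)" "\<bar>s * blinfun_apply w'' w'\<bar> < d"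
    using small_multiple_less[OF d, of "1 / (\<bar>\<tau>\<bar> + 1)"] by (auto simp: add_nonneg_pos)
  have "s * (\<bar>\<tau>\<bar> + 1) < 1" using s(2) by (simp add: pos_less_divide_eq add_nonneg_pos)
  moreover have "s * \<bar>\<tau>\<bar> \<ge> 0" "- (s * \<bar>\<tau>\<bar>) \<le> s * \<tau>"
    using s(1) mult_left_mono[of "- \<bar>\<tau>\<bar>" \<tau> s] by auto
  ultimately have pos: "0 \<le> 1 + s * \<tau>" using s(1) by (simp add: distrib_left)
  have "blinfun_apply (x'' + s *\<^sub>R w'') (x' + s *\<^sub>R w') \<le> (1 + s * \<tau>) * p + s * b"
  proof (rule type_NI_le[OF NI])
    fix a a' assume a: "(a, a') \<in> gra A"
    have "blinfun_apply x' a + blinfun_apply x'' a' - blinfun_apply a' a \<le> p"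
      using rel[OF a] by (simp add: p_def blinfun.bilinear_simps)
    then have "(1 + s * \<tau>) * (blinfun_apply x' a + blinfun_apply x'' a' - blinfun_apply a' a) \<le> (1 + s * \<tau>) * p"
      using pos by (rule mult_left_mono)
    moreover have "s * (blinfun_apply z' a + blinfun_apply z'' a' + \<tau> * blinfun_apply a' a) \<le> s * b"
      using fC[OF graph_hullI[OF a]] s(1) by (intro mult_left_mono) (auto simp: f)
    ultimately show "blinfun_apply (x' + s *\<^sub>R w') a + blinfun_apply (x'' + s *\<^sub>R w'') a' -
        blinfun_apply a' a \<le> (1 + s * \<tau>) * p + s * b"
      by (simp add: w'_def w''_def blinfun.bilinear_simps algebra_simps)
  qed
  moreover have "blinfun_apply (x'' + s *\<^sub>R w'') (x' + s *\<^sub>R w') =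
      p + s * (blinfun_apply x'' z' + blinfun_apply z'' x' + 2 * \<tau> * p + s * blinfun_apply w'' w')"
    unfolding blinfun.add_left blinfun.scaleR_left blinfun.add_right blinfun.scaleR_right
    by (simp add: w'_def w''_def p_def blinfun.bilinear_simps algebra_simps)
  ultimately have "s * (blinfun_apply x'' z' + blinfun_apply z'' x' + \<tau> * p + s * blinfun_apply w'' w') \<le> s * b"
    by (simp add: algebra_simps)
  then have "blinfun_apply x'' z' + blinfun_apply z'' x' + \<tau> * p + s * blinfun_apply w'' w' \<le> b"
    using s(1) by simp
  with low s(3) show False by linarith
qed

text \<open>The hull point from \<open>bidual_approximation\<close> has gap below
  \<open>e\<^sup>2\<close> if its tolerance \<open>h\<close> is small enough, so
  \<open>brondsted_rockafellar\<close> replaces it by a graph point at distance at most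
  \<open>8 * e\<close>.\<close>

lemma bidual_graph_approximation:
  fixes A :: "'a::banach \<Rightarrow> 'a dual set"
  assumes A: "maximally_monotone A" and NI: "type_NI A" and F: "finite F" and d: "d > 0"
    and rel: "\<And>a a'. (a, a') \<in> gra A \<Longrightarrow>
      0 \<le> blinfun_apply (canonical_embedding a - x'') (a' - x')"
  obtains a a' where "(a, a') \<in> gra A" "norm a \<le> norm x'' + 10" "norm (a' - x') < d"
    "\<forall>\<phi>\<in>F. \<bar>blinfun_apply \<phi> a - blinfun_apply x'' \<phi>\<bar> < d"
proof -
  define B where "B = (\<Sum>\<phi>\<in>F. norm \<phi>)"
  have B: "B \<ge> 0" "\<And>\<phi>. \<phi> \<in> F \<Longrightarrow> norm \<phi> \<le> B"
    unfolding B_def using F by (auto intro: sum_nonneg member_le_sum)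
  \<comment> \<open>The factor in the estimate of the gap by \<open>h * K\<close>; hence
    \<open>h = e\<^sup>2 / K\<close>.\<close>
  define K where "K = norm x' + norm x'' + 4"
  have K: "K \<ge> 1" by (simp add: K_def add_nonneg_nonneg)
  obtain e where e: "0 < e" "e < 1" "\<bar>e * (10 + 9 * B)\<bar> < d"
    using small_multiple_less[OF d, of 1] by auto
  define h where "h = e\<^sup>2 / K"
  have e2: "e\<^sup>2 \<le> e" using e by (simp add: power2_eq_square mult_left_le_one_le)
  have h: "h > 0" "h * K = e\<^sup>2" using e K by (auto simp: h_def)
  have "h \<le> e\<^sup>2" using h K mult_left_mono[of 1 K h] by simp
  with e2 have he: "h \<le> e" by simp
  \<comment> \<open>Adding \<open>x'\<close> to \<open>F\<close> keeps \<open>x' y\<close> close to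
    \<open>x'' x'\<close>, which controls the gap.\<close>
  obtain x y' r y where hull: "(x, y', r) \<in> graph_hull (gra A)" and y: "norm y < norm x'' + 1"
    "\<forall>\<phi>\<in>insert x' F. \<bar>blinfun_apply \<phi> y - blinfun_apply x'' \<phi>\<bar> < h"
    and near: "norm (x - y) < h" "norm (y' - x') < h" "\<bar>r - blinfun_apply x'' x'\<bar> < h"
    using bidual_approximation[OF A NI finite.insertI[OF F, of x'] h(1) rel] by blast
  have "norm x \<le> norm y + norm (x - y)" using norm_triangle_sub[of x y] by (simp add: add.commute)
  then have nx: "norm x \<le> norm x'' + 2" using y(1) near(1) he e(2) by linarith
  have "- (h * norm x) \<le> blinfun_apply (y' - x') x"
    using blinfun_apply_norm_bounds(2)[of "y' - x'" x] mult_right_mono[of "norm (y' - x')" h "norm x"] near(2)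
    by simp
  moreover have "h * norm x \<le> h * (norm x'' + 2)"
    using nx h(1) by simp
  moreover have "- (norm x' * h) \<le> blinfun_apply x' (x - y)"
    using blinfun_apply_norm_bounds(2)[of x' "x - y"] mult_left_mono[of "norm (x - y)" h "norm x'"] near(1)
    by simp
  moreover have "blinfun_apply y' x =
      blinfun_apply (y' - x') x + blinfun_apply x' (x - y) + blinfun_apply x' y"
    by (simp add: blinfun.bilinear_simps)
  moreover have "blinfun_apply x'' x' - h < blinfun_apply x' y" using y(2) by (simp add: abs_less_iff)
  moreover have "r < blinfun_apply x'' x' + h" using near(3) by linarith
  ultimately have "r - blinfun_apply y' x < h + h + norm x' * h + h * (norm x'' + 2)" by linarith
  also have "\<dots> = h * K" by (simp add: K_def algebra_simps)
  finally have "r - blinfun_apply y' x < e\<^sup>2" using h by simp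
  from brondsted_rockafellar[OF A NI e(1) hull this] obtain a a'
    where a: "(a, a') \<in> gra A" "norm (a - x) \<le> 8 * e" "norm (a' - y') \<le> 8 * e" .
  have ay: "norm (a - y) \<le> 9 * e"
    using norm_triangle_ineq[of "a - x" "x - y"] a(2) near(1) he by simp
  have eB: "0 \<le> e * B" using e(1) B(1) by simp
  then have ed: "10 * e + 9 * (e * B) < d"
    using e(1,3) by (simp add: algebra_simps)
  show ?thesis
  proof (rule that[OF a(1)])
    show "norm a \<le> norm x'' + 10"
      using norm_triangle_sub[of a y] ay y(1) e(2) by simp
    show "norm (a' - x') < d"
      using norm_triangle_ineq[of "a' - y'" "y' - x'"] a(3) near(2) he ed eB e(1) by simp
    have "\<bar>blinfun_apply \<phi> a - blinfun_apply x'' \<phi>\<bar> < d" if \<phi>: "\<phi> \<in> F" for \<phi>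
    proof -
      have "\<bar>blinfun_apply \<phi> (a - y)\<bar> \<le> B * (9 * e)"
        using norm_blinfun[of \<phi> "a - y"] mult_mono[OF B(2)[OF \<phi>] ay B(1) norm_ge_zero] by simp
      moreover have "\<bar>blinfun_apply \<phi> y - blinfun_apply x'' \<phi>\<bar> < h" using y(2) \<phi> by blast
      moreover have "blinfun_apply \<phi> a = blinfun_apply \<phi> (a - y) + blinfun_apply \<phi> y"
        by (simp add: blinfun.bilinear_simps)
      ultimately show ?thesis
        using he ed e(1) by (simp add: algebra_simps abs_if split: if_splits)
    qed
    then show "\<forall>\<phi>\<in>F. \<bar>blinfun_apply \<phi> a - blinfun_apply x'' \<phi>\<bar> < d" by blast
  qed
qed

lemma limitin_strong_operator_topologyI:
  assumes "\<And>x. ((\<lambda>i. blinfun_apply (f i) x) \<longlongrightarrow> blinfun_apply l x) F"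
  shows "limitin strong_operator_topology f l F"
  unfolding limitin_def
proof (intro conjI allI impI)
  show "l \<in> topspace strong_operator_topology" by (simp add: strong_operator_topology_topspace)
  fix U assume "openin strong_operator_topology U \<and> l \<in> U"
  then obtain W where W: "open W" "U = blinfun_apply -` W" "blinfun_apply l \<in> W"
    by (auto simp: strong_operator_topology_def openin_pullback_topology)
  have "limitin (product_topology (\<lambda>_. euclidean) UNIV) (\<lambda>i. blinfun_apply (f i)) (blinfun_apply l) F"
    unfolding limitin_componentwise using assms by simp
  then have "((\<lambda>i. blinfun_apply (f i)) \<longlongrightarrow> blinfun_apply l) F"
    by (simp add: euclidean_product_topology)
  from topological_tendstoD[OF this W(1,3)] show "\<forall>\<^sub>F i in F. f i \<in> U"
    by (simp add: W(2))
qed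

text \<open>The net is indexed by a finite set of functionals and a natural number, giving the
  functionals tested and the tolerance \<open>1 / real (Suc n)\<close>.\<close>

lemma type_NI_imp_type_D:
  fixes A :: "'a::banach \<Rightarrow> 'a dual set"
  assumes A: "maximally_monotone A" and NI: "type_NI A"
  shows "type_D A"
  unfolding type_D_def
proof (intro allI impI)
  fix x'' :: "'a bidual" and x' :: "'a dual"
  assume inf: "0 \<le> (INF (a, a') \<in> gra A. ereal (blinfun_apply (canonical_embedding a - x'') (a' - x')))"
  have rel: "0 \<le> blinfun_apply (canonical_embedding a - x'') (a' - x')" if "(a, a') \<in> gra A" for a a'
    using order_trans[OF inf INF_lower[OF that]] by simp
  let ?\<Gamma> = "{F :: 'a dual set. finite F} \<times> (UNIV :: nat set)"
  let ?le = "\<lambda>(F, m) (H, n). F \<subseteq> H \<and> m \<le> (n :: nat)"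
  define R where "R = (\<lambda>(F, n) z. z \<in> gra A \<and> norm (fst z) \<le> norm x'' + 10 \<and>
    norm (snd z - x') < 1 / real (Suc n) \<and>
    (\<forall>\<phi>\<in>F. \<bar>blinfun_apply \<phi> (fst z) - blinfun_apply x'' \<phi>\<bar> < 1 / real (Suc n)))"
  have "\<exists>z. R i z" if i: "i \<in> ?\<Gamma>" for i
  proof -
    obtain F n where i_eq: "i = (F, n)" "finite F" using i by auto
    have "0 < 1 / real (Suc n)" by simp
    then obtain a a' where "(a, a') \<in> gra A" "norm a \<le> norm x'' + 10" "norm (a' - x') < 1 / real (Suc n)"
      "\<forall>\<phi>\<in>F. \<bar>blinfun_apply \<phi> a - blinfun_apply x'' \<phi>\<bar> < 1 / real (Suc n)"
      using bidual_graph_approximation[OF A NI i_eq(2) _ rel] by blast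
    then have "R i (a, a')" by (simp add: R_def i_eq)
    then show ?thesis by blast
  qed
  then have "\<forall>i\<in>?\<Gamma>. \<exists>z. R i z" by blast
  from bchoice[OF this] obtain z where zR: "\<forall>i\<in>?\<Gamma>. R i (z i)" ..
  have z: "z (F, n) \<in> gra A \<and> norm (fst (z (F, n))) \<le> norm x'' + 10 \<and>
      norm (snd (z (F, n)) - x') < 1 / real (Suc n) \<and>
      (\<forall>\<phi>\<in>F. \<bar>blinfun_apply \<phi> (fst (z (F, n))) - blinfun_apply x'' \<phi>\<bar> < 1 / real (Suc n))"
    if "finite F" for F n
    using zR[rule_format, of "(F, n)"] that by (simp add: R_def)
  have dir: "directed_set ?\<Gamma> ?le"
    unfolding directed_set_def
  proof (intro conjI ballI impI)
    fix i j assume "i \<in> ?\<Gamma>" "j \<in> ?\<Gamma>"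
    then show "\<exists>k\<in>?\<Gamma>. ?le i k \<and> ?le j k"
      by (intro bexI[of _ "(fst i \<union> fst j, max (snd i) (snd j))"]) auto
  qed auto
  have small: "\<exists>n. 1 / real (Suc n) < e" if "e > 0" for e :: real
    using nat_approx_posE[OF that] by blast
  have le_mono: "1 / real (Suc n) \<le> 1 / real (Suc m)" if "m \<le> n" for m n
    using that by (intro divide_left_mono) auto
  have "bounded_net_limit (gra A) ?\<Gamma> ?le z (x'', x')"
    unfolding bounded_net_limit_def
  proof (intro conjI dir)
    show "z ` ?\<Gamma> \<subseteq> gra A" using z by auto
    have "norm (z i) \<le> norm x'' + 10 + (norm x' + 1)" if i: "i \<in> ?\<Gamma>" for i
    proof -
      obtain F n where i_eq: "i = (F, n)" "finite F" using i by auto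
      have "norm (snd (z i)) \<le> norm x' + norm (snd (z i) - x')"
        by (rule norm_triangle_sub)
      moreover have "norm (snd (z i) - x') < 1"
      proof -
        have "norm (snd (z i) - x') < 1 / real (Suc n)" using z[OF i_eq(2)] unfolding i_eq(1) by blast
        also have "\<dots> \<le> 1" by simp
        finally show ?thesis .
      qed
      moreover have "norm (z i) \<le> norm (fst (z i)) + norm (snd (z i))"
        using norm_Pair_le[of "fst (z i)" "snd (z i)"] by simp
      ultimately show ?thesis using z[OF i_eq(2), of n] by (simp add: i_eq)
    qed
    then show "bounded (z ` ?\<Gamma>)" by (auto simp: bounded_iff)
    have "((\<lambda>i. blinfun_apply (canonical_embedding (fst (z i))) \<phi>) \<longlongrightarrow> blinfun_apply x'' \<phi>) (net_filter ?\<Gamma> ?le)" for \<phi>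
    proof (rule tendstoI)
      fix e :: real assume "e > 0"
      then obtain n where n: "1 / real (Suc n) < e" using small by blast
      show "\<forall>\<^sub>F i in net_filter ?\<Gamma> ?le. dist (blinfun_apply (canonical_embedding (fst (z i))) \<phi>) (blinfun_apply x'' \<phi>) < e"
        unfolding eventually_net_filter[OF dir]
      proof (intro bexI[of _ "({\<phi>}, n)"] ballI impI)
        fix j assume j: "j \<in> ?\<Gamma>" "?le ({\<phi>}, n) j"
        then obtain H m where j_eq: "j = (H, m)" "finite H" "\<phi> \<in> H" "n \<le> m" by auto
        have "\<bar>blinfun_apply \<phi> (fst (z (H, m))) - blinfun_apply x'' \<phi>\<bar> < 1 / real (Suc m)"
          using z[OF j_eq(2), of m] j_eq(3) by blast
        also note le_mono[OF j_eq(4)]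
        also note n
        finally show "dist (blinfun_apply (canonical_embedding (fst (z j))) \<phi>) (blinfun_apply x'' \<phi>) < e"
          by (simp add: j_eq dist_real_def)
      qed auto
    qed
    then have "limitin strong_operator_topology (\<lambda>i. canonical_embedding (fst (z i))) x'' (net_filter ?\<Gamma> ?le)"
      by (rule limitin_strong_operator_topologyI)
    moreover have "((\<lambda>i. snd (z i)) \<longlongrightarrow> x') (net_filter ?\<Gamma> ?le)"
    proof (rule tendstoI)
      fix e :: real assume "e > 0"
      then obtain n where n: "1 / real (Suc n) < e" using small by blast
      show "\<forall>\<^sub>F i in net_filter ?\<Gamma> ?le. dist (snd (z i)) x' < e"
        unfolding eventually_net_filter[OF dir]
      proof (intro bexI[of _ "({}, n)"] ballI impI)
        fix j assume j: "j \<in> ?\<Gamma>" "?le ({}, n) j"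
        then obtain H m where j_eq: "j = (H, m)" "finite H" "n \<le> m" by auto
        have "norm (snd (z (H, m)) - x') < 1 / real (Suc m)"
          using z[OF j_eq(2), of m] by blast
        also note le_mono[OF j_eq(3)]
        also note n
        finally show "dist (snd (z j)) x' < e" by (simp add: j_eq dist_norm)
      qed auto
    qed
    ultimately show "limitin (prod_topology strong_operator_topology euclidean)
        (\<lambda>i. (canonical_embedding (fst (z i)), snd (z i))) (x'', x') (net_filter ?\<Gamma> ?le)"
      by (simp add: limitin_pairwise o_def)
  qed
  \<comment> \<open>Passes to the index type fixed in \<open>type_D\<close>.\<close>
  from bounded_net_limit_reindex[OF this]
  show "\<exists>(\<Gamma> :: ('a bidual \<times> 'a dual) set set) le z. bounded_net_limit (gra A) \<Gamma> le z (x'', x')" .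
qed

lemma small_sqrt_affine:
  fixes p q e r :: real
  assumes "e > 0" "r > 0"
  obtains h where "0 < h" "h < r" "sqrt (p * h) + q * h < e"
proof -
  have "((\<lambda>h. sqrt (p * h) + q * h) \<longlongrightarrow> sqrt (p * 0) + q * 0) (at_right 0)"
    by (intro tendsto_intros)
  then have "\<forall>\<^sub>F h in at_right 0. sqrt (p * h) + q * h < e"
    using assms(1) by (intro order_tendstoD(2)) auto
  moreover have "\<forall>\<^sub>F h in at_right 0. h \<in> {0<..<r}"
    by (rule eventually_at_right_real[OF assms(2)])
  ultimately have "\<forall>\<^sub>F h in at_right (0::real). h \<in> {0<..<r} \<and> sqrt (p * h) + q * h < e"
    by (rule eventually_conj[rotated])
  then obtain h where "h \<in> {0<..<r} \<and> sqrt (p * h) + q * h < e"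
    using eventually_happens'[OF trivial_limit_at_right_real] by blast
  with that show ?thesis by auto
qed

lemma convex_ball_segment_mem:
  fixes U :: "'v::real_normed_vector set"
  assumes "convex U" "ball x d \<subseteq> U" "ball (x + y) d \<subseteq> U" "0 \<le> s" "s \<le> 1"
    and z: "norm (z - x - s *\<^sub>R y) < d"
  shows "z \<in> U"
proof -
  define b where "b = z - x - s *\<^sub>R y"
  have "norm b < d" using z by (simp add: b_def)
  then have "x + b \<in> ball x d" "x + y + b \<in> ball (x + y) d"
    by (simp_all add: dist_norm)
  then have "x + b \<in> U" "x + y + b \<in> U" using assms by blast+
  then have "(1 - s) *\<^sub>R (x + b) + s *\<^sub>R (x + y + b) \<in> U"
    using assms by (intro convexD) auto
  also have "(1 - s) *\<^sub>R (x + b) + s *\<^sub>R (x + y + b) = z"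
    by (simp add: b_def algebra_simps)
  finally show ?thesis .
qed

text \<open>
  The penalty in \<open>type_NI_regularized\<close> with large \<open>l\<close> forces the dual component of the approximate
  minimiser close to the segment joining \<open>x0'\<close> to a point of the range inside \<open>U\<close>; monotonicity
  relative to \<open>U\<close> then makes all penalty terms small.
\<close>

lemma type_NI_imp_type_FP:
  fixes A :: "'a::banach \<Rightarrow> 'a dual set"
  assumes A: "maximally_monotone A" and NI: "type_NI A"
  shows "type_FP A"
  unfolding type_FP_def
proof (intro allI impI, elim conjE)
  fix U :: "'a dual set" and x0 :: 'a and x0' :: "'a dual"
  assume U: "open U" "convex U" and meet: "U \<inter> ran_op A \<noteq> {}" and x0'U: "x0' \<in> U"
    and related: "monotonically_related (x0, x0') (gra A \<inter> UNIV \<times> U)"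
  have mono: "monotone_set (gra A)" using A by (simp add: maximally_monotone_def)
  have rel: "0 \<le> blinfun_apply (a' - x0') (a - x0)" if "(a, a') \<in> gra A" "a' \<in> U" for a a'
    using related that unfolding monotonically_related_def monotone_set_def by fastforce
  obtain a0 a0' where a0: "(a0, a0') \<in> gra A" "a0' \<in> U"
    using meet by (auto simp: ran_op_def gra_def)
  define y' where "y' = a0' - x0'"
  define b where "b = a0 - x0"
  have a0_eq: "a0' = x0' + y'" "a0 = x0 + b" by (simp_all add: y'_def b_def)
  obtain d1 where d1: "d1 > 0" "ball x0' d1 \<subseteq> U" using U(1) x0'U openE by blast
  obtain d2 where d2: "d2 > 0" "ball a0' d2 \<subseteq> U" using U(1) a0(2) openE by blast
  define d where "d = min d1 d2"
  have d: "d > 0" using d1 d2 by (simp add: d_def)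
  have U_mem: "z \<in> U" if "0 \<le> s" "s \<le> 1" "norm (z - x0' - s *\<^sub>R y') < d" for z s
    using d1(2) d2(2) that by (intro convex_ball_segment_mem[OF U(2), of x0' d y' s]) (auto simp: d_def a0_eq)
  \<comment> \<open>All constants are fixed before \<open>h\<close>: \<open>P\<close> enters the a
    priori bound on the penalty, \<open>l\<close> is so large that the bound gives
    \<open>t < d / 2\<close>, \<open>N\<close> bounds \<open>norm v\<close>, and \<open>K\<close>
    and \<open>L\<close> bound the pairing and the penalty in multiples of \<open>h\<close>.\<close>
  define P where "P = 2 + 2 * norm b * norm y'"
  define l where "l = 2 * (4 * P / d\<^sup>2 + 2 * norm b / d) + 2"
  have P: "P > 0" by (simp add: P_def add_pos_nonneg)
  have l: "l > 0" using P d by (simp add: l_def add_nonneg_pos)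
  define N where "N = 2 * l * (P + d * norm b) + 1"
  have N: "N \<ge> 1" using l P d by (simp add: N_def)
  define K where "K = 8 * (d + norm y') + 8 * N + 64"
  define L where "L = 1 + K"
  have L: "L > 0" using N d by (simp add: L_def K_def add_pos_nonneg)
  show "(x0, x0') \<in> gra A"
  proof (rule gra_memI_graph_hull[OF A])
    fix e :: real assume e: "e > 0"
    obtain h where h: "0 < h" "h < min 1 (d / 16)"
      and h_e: "sqrt ((2 * l + 2 / l) * L * h) + (8 + L * norm y') * h < e"
      using small_sqrt_affine[OF e, of "min 1 (d / 16)" "(2 * l + 2 / l) * L" "8 + L * norm y'"] d
      by auto
    obtain x x' r s where hull: "(x, x', r) \<in> graph_hull (gra A)" and s: "0 \<le> s" "s \<le> 1"
      and *: "r - blinfun_apply x0' x - blinfun_apply x' x0 + blinfun_apply x0' x0 +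
        max 0 (- blinfun_apply y' (x - x0) - 1) + (norm (x - x0))\<^sup>2 / (2 * l) +
        l / 2 * (norm (x' - x0' - s *\<^sub>R y'))\<^sup>2 + s < h\<^sup>2"
      by (rule type_NI_regularized[OF NI gra_nonempty[OF A] l, of "h\<^sup>2" x0' x0 y']) (use h in simp)
    define v where "v = x - x0"
    define v' where "v' = x' - x0'"
    have x_eq: "x = x0 + v" "x' = x0' + v'" by (simp_all add: v_def v'_def)
    define c where "c = r - blinfun_apply x0' x - blinfun_apply x' x0 + blinfun_apply x0' x0"
    define m where "m = max 0 (- blinfun_apply y' v - 1)"
    define t where "t = norm (v' - s *\<^sub>R y')"
    have t0: "t \<ge> 0" by (simp add: t_def)
    have main: "c + m + (norm v)\<^sup>2 / (2 * l) + l / 2 * t\<^sup>2 + s < h\<^sup>2"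
      using * by (simp add: c_def m_def t_def v_def v'_def)
    have r: "r - blinfun_apply x' x = c - blinfun_apply v' v"
      by (simp add: c_def x_eq blinfun.bilinear_simps)
    have h2: "h\<^sup>2 \<le> h" using h by (simp add: power2_eq_square mult_left_le_one_le)
    have m: "0 \<le> m" "- blinfun_apply y' v - 1 \<le> m" by (simp_all add: m_def)
    have sy: "norm (s *\<^sub>R y') \<le> norm y'" using s by (simp add: mult_left_le_one_le)
    have v'_le: "norm v' \<le> t + norm (s *\<^sub>R y')"
      using norm_triangle_sub[of v' "s *\<^sub>R y'"] by (simp add: t_def)
    \<comment> \<open>Fenchel-Young: the penalty dominates \<open>- v' v\<close>, so the gap is at
      most the value of the regularised expression.\<close>
    have gap: "r - blinfun_apply x' x < h\<^sup>2"
    proof -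
      have "- blinfun_apply (v' - s *\<^sub>R y') v \<le> norm v * t"
        using blinfun_apply_norm_bounds(2)[of "v' - s *\<^sub>R y'" v] by (simp add: t_def mult.commute)
      also have "\<dots> \<le> (norm v)\<^sup>2 / (2 * l) + l / 2 * t\<^sup>2" by (rule le_young[OF l])
      finally have 1: "- blinfun_apply v' v + s * blinfun_apply y' v \<le> (norm v)\<^sup>2 / (2 * l) + l / 2 * t\<^sup>2"
        by (simp add: blinfun.bilinear_simps)
      have "s * (- blinfun_apply y' v - 1) \<le> s * m" using m(2) s(1) by (rule mult_left_mono)
      also have "\<dots> \<le> m" using m(1) s by (simp add: mult_left_le_one_le)
      finally have "- (s * blinfun_apply y' v) \<le> m + s" by (simp add: algebra_simps)
      with 1 main r show ?thesis by linarith
    qed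
    \<comment> \<open>The hull inequality at \<open>(a0, a0')\<close> bounds \<open>c\<close> below
      up to the term \<open>y' v\<close>, and the hinge \<open>m\<close> absorbs exactly that term.
      The resulting bound does not depend on \<open>l\<close>.\<close>
    have bound: "(norm v)\<^sup>2 / (2 * l) + l / 2 * t\<^sup>2 < P + t * norm b"
    proof -
      have "blinfun_apply a0' x + blinfun_apply x' a0 - blinfun_apply a0' a0 \<le> r"
        by (rule graph_hull_ge[OF mono a0(1) hull])
      then have "blinfun_apply y' v + blinfun_apply v' b - blinfun_apply y' b \<le> c"
        by (simp add: c_def x_eq a0_eq blinfun.bilinear_simps)
      moreover have "- ((t + norm y') * norm b) \<le> blinfun_apply v' b"
        using blinfun_apply_norm_bounds(2)[of v' b] mult_right_mono[of "norm v'" "t + norm y'" "norm b"]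
          v'_le sy by simp
      moreover have "blinfun_apply y' b \<le> norm y' * norm b" by (rule blinfun_apply_norm_bounds)
      moreover have "h\<^sup>2 < 1" using h2 h by simp
      moreover have "(t + norm y') * norm b = t * norm b + norm y' * norm b" by (simp add: distrib_right)
      moreover have "norm b * norm y' = norm y' * norm b" by simp
      ultimately show ?thesis using main m(2) s(1) unfolding P_def by linarith
    qed
    have td: "t < d / 2"
    proof (rule ccontr)
      assume "\<not> t < d / 2"
      then have t: "d \<le> 2 * t" by simp
      have "d * d \<le> (2 * t) * (2 * t)" using t d by (intro mult_mono) auto
      then have "P \<le> 4 * P / d\<^sup>2 * t\<^sup>2"
        using d P by (simp add: power2_eq_square field_simps)
      moreover have "d * t \<le> (2 * t) * t" using t t0 by (rule mult_right_mono)
      then have "norm b * (d * t) \<le> norm b * ((2 * t) * t)" by (intro mult_left_mono) auto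
      then have "t * norm b \<le> 2 * norm b / d * t\<^sup>2"
        using d by (simp add: power2_eq_square field_simps)
      moreover have "l / 2 * t\<^sup>2 = 4 * P / d\<^sup>2 * t\<^sup>2 + 2 * norm b / d * t\<^sup>2 + t\<^sup>2"
        by (simp add: l_def algebra_simps add_divide_distrib)
      moreover have "0 \<le> (norm v)\<^sup>2 / (2 * l)" using l by simp
      ultimately show False using bound zero_le_power2[of t] by linarith
    qed
    \<comment> \<open>Since \<open>h < d / 16\<close>, the correction \<open>8 * h\<close> is below
      \<open>d / 2\<close>; together with \<open>td\<close> this puts \<open>a'\<close> in
      \<open>U\<close>, where the relation to \<open>(x0, x0')\<close> is available.\<close>
    obtain a a' where a: "(a, a') \<in> gra A" "norm (a - x) \<le> 8 * h" "norm (a' - x') \<le> 8 * h"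
      using brondsted_rockafellar[OF A NI h(1) hull gap] .
    define w where "w = a - x"
    define w' where "w' = a' - x'"
    have w: "norm w \<le> 8 * h" "norm w' \<le> 8 * h" using a by (simp_all add: w_def w'_def)
    have a_eq: "a = x0 + (v + w)" "a' = x0' + (v' + w')" by (simp_all add: w_def w'_def x_eq)
    have "norm (a' - x0' - s *\<^sub>R y') \<le> norm (v' - s *\<^sub>R y') + norm w'"
      using norm_triangle_ineq[of "v' - s *\<^sub>R y'" w'] by (simp add: a_eq algebra_simps)
    also have "\<dots> < d" using td w(2) h(2) by (simp add: t_def)
    finally have "a' \<in> U" by (rule U_mem[OF s])
    from rel[OF a(1) this] have rel0: "0 \<le> blinfun_apply (v' + w') (v + w)" by (simp add: a_eq)
    have nv: "norm v \<le> N"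
    proof -
      have "0 \<le> l / 2 * t\<^sup>2" using l by simp
      moreover have "t * norm b \<le> d * norm b" using td t0 by (intro mult_right_mono) auto
      ultimately have "(norm v)\<^sup>2 / (2 * l) < P + d * norm b" using bound by linarith
      then have "(norm v)\<^sup>2 \<le> N"
        using l by (simp add: N_def field_simps)
      also have "\<dots> \<le> N\<^sup>2" using N by (simp add: power2_eq_square)
      finally show ?thesis using N by (simp add: power2_le_iff_abs_le)
    qed
    have nv': "norm v' \<le> d + norm y'" using v'_le sy td d by linarith
    have pair: "- (h * K) \<le> blinfun_apply v' v"
    proof -
      have "blinfun_apply v' w \<le> (d + norm y') * (8 * h)"
        using blinfun_apply_norm_bounds(1)[of v' w] mult_mono[OF nv' w(1)] d by force
      moreover have "blinfun_apply w' v \<le> (8 * h) * N"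
        using blinfun_apply_norm_bounds(1)[of w' v] mult_mono[OF w(2) nv] h by force
      moreover have "blinfun_apply w' w \<le> (8 * h) * (8 * h)"
        using blinfun_apply_norm_bounds(1)[of w' w] mult_mono[OF w(2) w(1)] h by force
      moreover have "(8 * h) * (8 * h) \<le> 64 * h" using h2 by (simp add: power2_eq_square)
      moreover have "h * K = (d + norm y') * (8 * h) + (8 * h) * N + 64 * h"
        by (simp add: K_def algebra_simps)
      moreover have "blinfun_apply (v' + w') (v + w) = blinfun_apply v' v + blinfun_apply v' w +
          blinfun_apply w' v + blinfun_apply w' w"
        by (simp add: blinfun.bilinear_simps)
      ultimately show ?thesis using rel0 by linarith
    qed
    \<comment> \<open>Combined with \<open>pair\<close> this bounds \<open>c\<close> below by a
      multiple of \<open>h\<close>, so each penalty term is at most \<open>L * h\<close>.\<close>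
    have "blinfun_apply v' v \<le> c" using graph_hull_ge_pairing[OF A hull] r by simp
    then have sum: "(norm v)\<^sup>2 / (2 * l) + l / 2 * t\<^sup>2 + s < L * h"
      using main pair m(1) h2 by (simp add: L_def algebra_simps)
    have nonneg: "0 \<le> (norm v)\<^sup>2 / (2 * l)" "0 \<le> l / 2 * t\<^sup>2" using l by simp_all
    \<comment> \<open>A common bound for \<open>norm v\<close>, with factor \<open>2 * l\<close>,
      and \<open>t\<close>, with factor \<open>2 / l\<close>.\<close>
    define S where "S = sqrt ((2 * l + 2 / l) * L * h)"
    have Lh: "L * h > 0" using L h by simp
    have S_ge: "u \<le> S" if "u\<^sup>2 \<le> q * (L * h)" "q \<le> 2 * l + 2 / l" for u q
    proof -
      have "u\<^sup>2 \<le> (2 * l + 2 / l) * L * h"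
        using that(1) mult_right_mono[OF that(2), of "L * h"] Lh by (simp add: mult.assoc)
      then show ?thesis unfolding S_def by (rule real_le_rsqrt)
    qed
    have "(norm v)\<^sup>2 / (2 * l) \<le> L * h" using sum nonneg s by linarith
    then have "(norm v)\<^sup>2 \<le> 2 * l * (L * h)" using l by (simp add: field_simps)
    then have vS: "norm v \<le> S" by (rule S_ge) (use l in simp)
    have "l / 2 * t\<^sup>2 \<le> L * h" using sum nonneg s by linarith
    then have "t\<^sup>2 \<le> 2 / l * (L * h)" using l by (simp add: field_simps)
    then have tS: "t \<le> S" by (rule S_ge) (use l in simp)
    have "s \<le> L * h" using sum nonneg by linarith
    then have "norm (s *\<^sub>R y') \<le> L * h * norm y'" using s by (simp add: mult_right_mono)
    then have v'S: "norm v' \<le> S + L * norm y' * h" using v'_le tS by (simp add: mult_ac)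
    have Se: "S + (8 + L * norm y') * h < e" using h_e by (simp add: S_def)
    have Ly: "0 \<le> L * norm y' * h" using L h by simp
    have "norm (a - x0) \<le> e" "norm (a' - x0') \<le> e"
      using norm_triangle_ineq[of v w] norm_triangle_ineq[of v' w'] w vS v'S Se Ly
      by (simp_all add: a_eq algebra_simps)
    \<comment> \<open>The graph point \<open>(a, a')\<close> itself is the witness; its gap is
      0.\<close>
    then show "\<exists>y y' r. (y, y', r) \<in> graph_hull (gra A) \<and> norm (y - x0) \<le> e \<and>
        norm (y' - x0') \<le> e \<and> r - blinfun_apply y' y \<le> e"
      using graph_hullI[OF a(1)] e by (intro exI[of _ a] exI[of _ a'] exI[of _ "blinfun_apply a' a"]) simp
  qed
qed

theorem corollary3p2:
  fixes A :: "'a::banach \<Rightarrow> ('a \<Rightarrow>\<^sub>L real) set"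
  assumes "maximally_monotone A"
  shows "(type_D A \<longleftrightarrow> type_NI A) \<and> (type_NI A \<longleftrightarrow> type_FP A)"
  using type_D_imp_type_NI type_NI_imp_type_D[OF assms] type_NI_imp_type_FP[OF assms]
    type_FP_imp_type_NI[OF assms] by blast

end
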